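(* Let $X$ be a finite skew brace of nilpotent type, let $A=(X,\cdot)$ and $L=L_\infty(X)$. Then $$\mathfrak{R}_L(X)=\operatorname{Id}_X(L)=\operatorname{Id}_X\bigl(\gamma_\infty(A)\bigr).$$ Equivalently, $\mathfrak{R}_L(X)$ is the smallest ideal $I$ of $X$ such that the group $A/I$ is nilpotent.
   Context: A skew (left) brace is a triple $X=(X,+,\cdot)$ such that $(X,+)$ and $(X,\cdot)$ are groups on the same set and $a\cdot(b+c)=a\cdot b-a+a\cdot c$ for all $a,b,c\in X$. The common identity is denoted $0$. $X$ is of nilpotent type if $(X,+)$ is a nilpotent group. Put $\lambda_a(b)=-a+a\cdot b$ and $a*b=\lambda_a(b)-b$. For subsets $S,T\subseteq X$, $S*T$ is the subgroup of $(X,+)$ generated by all $s*t$ with $s\in S$, $t\in T$. An ideal of $X$ is a subgroup of $(X,+)$ that is invariant under every $\lambda_a$ and normal in both $(X,+)$ and $(X,\cdot)$. $\operatorname{Id}_X(S)$ is the smallest ideal of $X$ containing the subset $S$. The left series is $X^1=X$, $X^{n+1}=X*X^n$ ($n\ge1$); $X$ is left nilpotent if $X^n=0$ for some $n$; $L_\infty(X)=\bigcap_{n\ge1}X^n$. The left-nilpotent residual is $\mathfrak{R}_L(X)=\bigcap\{I: I\text{ is an ideal of }X\text{ and }X/I\text{ is left nilpotent}\}$. For a finite group $H$, $\gamma_\infty(H)$ is the smallest normal subgroup of $H$ with nilpotent quotient. For an ideal $I$, $A/I$ is the quotient of $(X,\cdot)$ by its normal subgroup $I$. *)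

theory Defs
  imports "HOL-Algebra.QuotRing" "HOL-Algebra.Generated_Groups"
begin

section \<open>Nilpotent groups\<close>

text \<open>
  The lower central series, indexed from \<open>0\<close>: \<open>lower_central G n\<close> is
  \<open>\<gamma>\<^bsub>n+1\<^esub>(G)\<close>.
\<close>

primrec lower_central :: "('a, 'b) monoid_scheme \<Rightarrow> nat \<Rightarrow> 'a set" where
  "lower_central G 0 = carrier G"
| "lower_central G (Suc n) =
     generate G (\<Union>g \<in> carrier G. \<Union>h \<in> lower_central G n.
       {g \<otimes>\<^bsub>G\<^esub> h \<otimes>\<^bsub>G\<^esub> inv\<^bsub>G\<^esub> g \<otimes>\<^bsub>G\<^esub> inv\<^bsub>G\<^esub> h})"

definition nilpotent_group :: "('a, 'b) monoid_scheme \<Rightarrow> bool" where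
  "nilpotent_group G \<longleftrightarrow> group G \<and> (\<exists>n. lower_central G n = {\<one>\<^bsub>G\<^esub>})"

text \<open>
  The smallest (with respect to inclusion) normal subgroup with nilpotent quotient. It exists
  for finite groups; for arbitrary groups it need not.
\<close>

definition gamma_infinity :: "('a, 'b) monoid_scheme \<Rightarrow> 'a set" where
  "gamma_infinity H = (LEAST N. N \<lhd> H \<and> nilpotent_group (H Mod N))"


section \<open>Skew braces\<close>

text \<open>
  A skew brace is carried by a record of type \<^typ>\<open>('a, 'b) ring_scheme\<close>. Its additive group
  is \<^term>\<open>add_monoid X\<close>; since ring records extend monoid records, its multiplicative group is
  \<^term>\<open>X\<close> itself, so that group-theoretic notions applied directly to \<^term>\<open>X\<close> refer to the
  multiplication. Addition is not assumed to be commutative.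
\<close>

locale skew_brace =
  fixes X (structure)
  assumes add_group: "group (add_monoid X)"
    and mult_group: "group X"
    and brace: "\<lbrakk>a \<in> carrier X; b \<in> carrier X; c \<in> carrier X\<rbrakk> \<Longrightarrow>
      a \<otimes> (b \<oplus> c) = ((a \<otimes> b) \<ominus> a) \<oplus> (a \<otimes> c)"

lemma (in skew_brace) zero_eq_one: "\<zero> = \<one>"
proof -
  interpret A: group "add_monoid X" by (rule add_group)
  interpret M: group X by (rule mult_group)
  have z: "\<zero> \<in> carrier X" and o: "\<one> \<in> carrier X"
    using A.one_closed M.one_closed by simp_all
  have "\<zero> = \<one> \<otimes> (\<zero> \<oplus> \<zero>)"
    using z A.l_one[of "\<zero>"] by simp
  also have "\<dots> = (\<zero> \<ominus> \<one>) \<oplus> \<zero>"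
    using brace[OF o z z] z by simp
  also have "\<dots> = \<ominus> \<one>"
    using A.l_one[of "\<ominus> \<one>"] A.r_one[of "\<ominus> \<one>"] A.inv_closed[of "\<one>"] o
    by (simp add: a_minus_def a_inv_def)
  finally have "\<ominus> \<one> = \<zero>" by simp
  then show ?thesis
    using A.inv_inv[of "\<one>"] A.inv_one o by (simp add: a_inv_def)
qed

definition brace_lambda :: "('a, 'b) ring_scheme \<Rightarrow> 'a \<Rightarrow> 'a \<Rightarrow> 'a" where
  "brace_lambda X a b = (\<ominus>\<^bsub>X\<^esub> a) \<oplus>\<^bsub>X\<^esub> (a \<otimes>\<^bsub>X\<^esub> b)"

definition brace_star :: "('a, 'b) ring_scheme \<Rightarrow> 'a \<Rightarrow> 'a \<Rightarrow> 'a" where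
  "brace_star X a b = brace_lambda X a b \<ominus>\<^bsub>X\<^esub> b"

definition set_star :: "('a, 'b) ring_scheme \<Rightarrow> 'a set \<Rightarrow> 'a set \<Rightarrow> 'a set" where
  "set_star X S T = generate (add_monoid X) (\<Union>s \<in> S. \<Union>t \<in> T. {brace_star X s t})"

definition brace_ideal :: "('a, 'b) ring_scheme \<Rightarrow> 'a set \<Rightarrow> bool" where
  "brace_ideal X I \<longleftrightarrow>
     subgroup I (add_monoid X) \<and>
     (\<forall>a \<in> carrier X. \<forall>b \<in> I. brace_lambda X a b \<in> I) \<and>
     I \<lhd> add_monoid X \<and> I \<lhd> X"

definition ideal_generated :: "('a, 'b) ring_scheme \<Rightarrow> 'a set \<Rightarrow> 'a set" where
  "ideal_generated X S = (LEAST I. brace_ideal X I \<and> S \<subseteq> I)"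

text \<open>The left series, indexed from \<open>0\<close>: \<open>left_series X n\<close> is \<open>X\<^bsup>n+1\<^esup>\<close>.\<close>

primrec left_series :: "('a, 'b) ring_scheme \<Rightarrow> nat \<Rightarrow> 'a set" where
  "left_series X 0 = carrier X"
| "left_series X (Suc n) = set_star X (carrier X) (left_series X n)"

definition left_nilpotent :: "('a, 'b) ring_scheme \<Rightarrow> bool" where
  "left_nilpotent X \<longleftrightarrow> (\<exists>n. left_series X n = {\<zero>\<^bsub>X\<^esub>})"

definition L_infinity :: "('a, 'b) ring_scheme \<Rightarrow> 'a set" where
  "L_infinity X = (\<Inter>n. left_series X n)"

text \<open>
  The quotient brace is \<^term>\<open>X Quot I\<close>. Its carrier consists of the additive cosets of the ideal,
  which coincide with the multiplicative ones; the lemmas below confirm that its operations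
  are the expected ones although the library states its own results for rings only.
\<close>

definition left_nilpotent_residual :: "('a, 'b) ring_scheme \<Rightarrow> 'a set" where
  "left_nilpotent_residual X = \<Inter> {I. brace_ideal X I \<and> left_nilpotent (X Quot I)}"

lemma (in skew_brace) ideal_coset_eq:
  assumes "brace_ideal X I" and a: "a \<in> carrier X"
  shows "I +> a = I #> a"
proof -
  interpret A: group "add_monoid X" by (rule add_group)
  interpret M: group X by (rule mult_group)
  have lam: "\<And>a b. a \<in> carrier X \<Longrightarrow> b \<in> I \<Longrightarrow> brace_lambda X a b \<in> I"
    and nA: "I \<lhd> add_monoid X" and nM: "I \<lhd> X"
    using assms(1) by (auto simp: brace_ideal_def)
  have sub: "I \<subseteq> carrier X"
    using nM normal_imp_subgroup subgroup.subset by blast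
  have mult: "a \<otimes> b = a \<oplus> brace_lambda X a b" if "a \<in> carrier X" "b \<in> carrier X" for a b
    using that A.m_assoc[of a "\<ominus> a" "a \<otimes> b"] A.r_inv[of a] A.inv_closed[of a] A.l_one[of "a \<otimes> b"]
    by (simp add: brace_lambda_def a_inv_def)
  have "a <# I = a <#\<^bsub>add_monoid X\<^esub> I"
  proof
    show "a <# I \<subseteq> a <#\<^bsub>add_monoid X\<^esub> I"
      using mult lam a sub by (fastforce simp: l_coset_def)
    show "a <#\<^bsub>add_monoid X\<^esub> I \<subseteq> a <# I"
    proof
      fix x assume "x \<in> a <#\<^bsub>add_monoid X\<^esub> I"
      then obtain i where i: "i \<in> I" and x: "x = a \<oplus> i" by (auto simp: l_coset_def)
      define b where "b = brace_lambda X (inv a) i"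
      have b: "b \<in> I" using lam i a b_def by simp
      have "a \<oplus> i = a \<otimes> b"
      proof -
        let ?c = "inv a"
        have c: "?c \<in> carrier X" and ic: "i \<in> carrier X" using a i sub by auto
        have bc: "b \<in> carrier X" using b sub by auto
        have "?c \<otimes> i = ?c \<oplus> b" using mult[OF c ic] b_def by simp
        then have "a \<otimes> (?c \<otimes> i) = ((a \<otimes> ?c) \<ominus> a) \<oplus> (a \<otimes> b)"
          using brace[OF a c bc] by simp
        moreover have "a \<otimes> (?c \<otimes> i) = i" using a c ic by (simp flip: M.m_assoc)
        moreover have "(a \<otimes> ?c) \<ominus> a = \<ominus> a"
          using a A.l_one[of "\<ominus> a"] A.inv_closed[of a]
          by (simp add: a_minus_def a_inv_def flip: zero_eq_one)
        ultimately have "i = \<ominus> a \<oplus> (a \<otimes> b)" by simp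
        then have "i = brace_lambda X a b" by (simp add: brace_lambda_def)
        then show ?thesis using mult[OF a bc] by simp
      qed
      then show "x \<in> a <# I" using b x by (auto simp: l_coset_def)
    qed
  qed
  moreover have "I +> a = a <#\<^bsub>add_monoid X\<^esub> I"
    using normal.coset_eq[OF nA] a by (simp add: a_r_coset_def)
  moreover have "I #> a = a <# I"
    using normal.coset_eq[OF nM] a by simp
  ultimately show ?thesis by simp
qed

lemma (in skew_brace) quot_mult:
  assumes I: "brace_ideal X I" and a: "a \<in> carrier X" and b: "b \<in> carrier X"
  shows "(I +> a) \<otimes>\<^bsub>X Quot I\<^esub> (I +> b) = I +> (a \<otimes> b)"
proof -
  interpret M: group X by (rule mult_group)
  have nM: "I \<lhd> X" using I by (simp add: brace_ideal_def)
  interpret N: normal I X by (rule nM)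
  have sub: "I #> a \<subseteq> carrier X" "I #> b \<subseteq> carrier X"
    using a b M.r_coset_subset_G N.subset by auto
  have "I +> (x \<otimes> y) = I #> (a \<otimes> b)" if x: "x \<in> I #> a" and y: "y \<in> I #> b" for x y
  proof -
    have xy: "x \<in> carrier X" "y \<in> carrier X" using x y sub by auto
    have "x \<otimes> y \<in> (I #> a) <#> (I #> b)" using x y by (auto simp: set_mult_def)
    then have "x \<otimes> y \<in> I #> (a \<otimes> b)" using N.rcos_sum a b by simp
    then have "I #> (x \<otimes> y) = I #> (a \<otimes> b)"
      using M.repr_independence[of "x \<otimes> y" I "a \<otimes> b"] a b N.subgroup_axioms by simp
    then show ?thesis using ideal_coset_eq[OF I] xy by simp
  qed
  moreover have "a \<in> I #> a" "b \<in> I #> b"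
    using a b M.rcos_self N.subgroup_axioms by auto
  ultimately show ?thesis
    using a b by (auto simp: FactRing_def rcoset_mult_def ideal_coset_eq[OF I])
qed

lemma (in skew_brace) quot_add:
  assumes I: "brace_ideal X I" and a: "a \<in> carrier X" and b: "b \<in> carrier X"
  shows "(I +> a) \<oplus>\<^bsub>X Quot I\<^esub> (I +> b) = I +> (a \<oplus> b)"
  using normal.rcos_sum[of I "add_monoid X" a b] assms
  by (simp add: brace_ideal_def FactRing_def set_add_def a_r_coset_def)

end

theory Submission
  imports Defs "HOL-Algebra.Sylow" "HOL-Algebra.Zassenhaus" "HOL-Algebra.Multiplicative_Group"
begin

text \<open>
  The theorem reduces to one fact: a finite skew brace of nilpotent type is left nilpotent if and
  only if its multiplicative group is nilpotent (\<open>left_nilpotent_iff_nilpotent\<close>). Quotients of \<open>X\<close>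
  are again finite of nilpotent type, so for an ideal \<open>I\<close> the brace \<open>X/I\<close> is left nilpotent
  exactly when the group \<open>A/I\<close> is nilpotent. Both the left series and the lower central series of
  a quotient are images of those of \<open>X\<close>, and both become stationary by finiteness; hence the first
  condition says that \<open>I\<close> contains \<open>L\<^sub>\<infinity>(X)\<close>, and the second that \<open>I\<close> contains
  \<open>\<gamma>\<^sub>\<infinity>(A)\<close>. The residual, the ideal generated by either set, and the smallest ideal with
  nilpotent quotient group are then intersections of one and the same family of ideals.

  The equivalence rests on the Sylow subgroups of the additive group. As that group is nilpotent, its
  Sylow \<open>p\<close>-subgroup is the set \<open>P\<^sub>p\<close> of all elements of \<open>p\<close>-power order
  (\<open>nilpotent_primary_sylow\<close>). It is preserved by all \<open>\<lambda>\<^sub>a\<close> and is therefore also a Sylow subgroup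
  of the multiplicative group (\<open>P_sylow\<close>). Each of the two kinds of nilpotency implies that
  \<open>P\<^sub>q\<close> acts trivially on \<open>P\<^sub>p\<close> for \<open>q \<noteq> p\<close>. If the multiplicative group is
  nilpotent, this is because elements of coprime order commute in both groups; if the brace is left
  nilpotent, it is because coprime automorphisms that stabilize a series are trivial
  (\<open>coprime_action_trivial\<close>).

  Conversely, this triviality gives both kinds of nilpotency, by a single argument. The left series
  and the lower central series are instances of a series attached to any action of a group on another
  by automorphisms. When the parts for different primes act trivially on each other, the orbits on
  cosets inside the \<open>p\<close>-part have \<open>p\<close>-power length, so counting yields fixed points modulo any
  proper invariant subgroup; an ascending series of fixed points reaches the whole group and forces
  the descending series to reach the trivial one (\<open>displacement_series_reaches_one\<close>).
\<close>

section \<open>Elements of prime power order\<close>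

lemma dvd_if_prime_parts_dvd:
  fixes m n :: nat
  assumes "n \<noteq> 0" and "\<And>p. prime p \<Longrightarrow> p ^ multiplicity p n dvd m"
  shows "n dvd m"
proof (cases "m = 0")
  case False
  have "multiplicity p n \<le> multiplicity p m" if "prime p" for p
    using assms(2)[OF that] False that by (intro multiplicity_geI) auto
  then show ?thesis using assms(1) by (intro multiplicity_le_imp_dvd) auto
qed simp

lemma (in group) inv_mult_cancel:
  assumes "x \<in> carrier G" "y \<in> carrier G"
  shows "x \<otimes> (inv x \<otimes> y) = y" "inv x \<otimes> (x \<otimes> y) = y"
  using assms by (simp_all flip: m_assoc)

lemma (in group) card_subgroup_dvd:
  assumes "subgroup H G" "subgroup K G" "H \<subseteq> K"
  shows "card H dvd card K"
proof -
  interpret K: group "G\<lparr>carrier := K\<rparr>" by (rule subgroup_imp_group[OF assms(2)])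
  have "subgroup H (G\<lparr>carrier := K\<rparr>)" by (rule subgroup_incl[OF assms])
  from K.lagrange[OF this] have "card (rcosets\<^bsub>G\<lparr>carrier := K\<rparr>\<^esub> H) * card H = card K"
    by (simp add: order_def)
  then show ?thesis by (metis dvd_triv_right)
qed

lemma (in group) normalizer_iff:
  assumes U: "U \<subseteq> carrier G"
  shows "x \<in> normalizer G U \<longleftrightarrow>
    x \<in> carrier G \<and> (\<forall>u \<in> carrier G. x \<otimes> u \<otimes> inv x \<in> U \<longleftrightarrow> u \<in> U)"
proof -
  have eq: "x <# U #> inv x = (\<lambda>u. x \<otimes> u \<otimes> inv x) ` U"
    by (auto simp: l_coset_def r_coset_def)
  have "(\<lambda>u. x \<otimes> u \<otimes> inv x) ` U = U \<longleftrightarrow>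
      (\<forall>u \<in> carrier G. x \<otimes> u \<otimes> inv x \<in> U \<longleftrightarrow> u \<in> U)" (is "?L = U \<longleftrightarrow> ?R")
    if x: "x \<in> carrier G"
  proof
    assume L: "?L = U"
    show ?R
    proof (intro ballI iffI)
      fix u assume u: "u \<in> carrier G" and "x \<otimes> u \<otimes> inv x \<in> U"
      then obtain v where v: "v \<in> U" "x \<otimes> u \<otimes> inv x = x \<otimes> v \<otimes> inv x" using L by blast
      then have "u = v" using x u U by (auto simp: subset_iff)
      then show "u \<in> U" using v by simp
    qed (use L in blast)
  next
    assume R: ?R
    have "u \<in> ?L" if u: "u \<in> U" for u
    proof
      have uc: "u \<in> carrier G" using u U by auto
      show e: "u = x \<otimes> (inv x \<otimes> u \<otimes> x) \<otimes> inv x"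
        using x uc by (simp add: m_assoc inv_mult_cancel)
      show "inv x \<otimes> u \<otimes> x \<in> U" using R e x uc u by (metis inv_closed m_closed)
    qed
    then show "?L = U" using R U by auto
  qed
  then show ?thesis using U by (auto simp: normalizer_def stabilizer_def eq)
qed

definition primary_elements :: "('a, 'b) monoid_scheme \<Rightarrow> nat \<Rightarrow> 'a set" where
  "primary_elements G p = {x \<in> carrier G. \<exists>k. x [^]\<^bsub>G\<^esub> (p ^ k) = \<one>\<^bsub>G\<^esub>}"

lemma primary_elementsI:
  "x \<in> carrier G \<Longrightarrow> x [^]\<^bsub>G\<^esub> (p ^ k) = \<one>\<^bsub>G\<^esub> \<Longrightarrow> x \<in> primary_elements G p"
  by (auto simp: primary_elements_def)

lemma (in group) prime_power_subgroup_subset_primary: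
  assumes "subgroup H G" "card H = p ^ k" "finite H"
  shows "H \<subseteq> primary_elements G p"
proof
  fix x assume x: "x \<in> H"
  interpret H: group "G\<lparr>carrier := H\<rparr>" by (rule subgroup_imp_group[OF assms(1)])
  have "x [^]\<^bsub>G\<lparr>carrier := H\<rparr>\<^esub> order (G\<lparr>carrier := H\<rparr>) = \<one>"
    using H.pow_order_eq_1[of x] x by simp
  then have "x [^] (p ^ k) = \<one>"
    using assms(2) by (simp add: order_def nat_pow_consistent[symmetric])
  then show "x \<in> primary_elements G p"
    using x subgroup.subset[OF assms(1)] by (auto simp: primary_elements_def)
qed

lemma (in group) pow_coprime_eq_one:
  assumes "x \<in> carrier G" "x [^] (m::nat) = \<one>" "x [^] (n::nat) = \<one>" "coprime m n"
  shows "x = \<one>"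
proof -
  have "ord x dvd m" "ord x dvd n" using assms pow_eq_id by auto
  then have "ord x = 1" using assms(4) by (meson coprime_common_divisor_nat)
  then show ?thesis using assms(1) ord_eq_1 by auto
qed

lemma (in group) primary_elements_Int:
  assumes "prime p" "prime q" "p \<noteq> q"
    and "x \<in> primary_elements G p" "x \<in> primary_elements G q"
  shows "x = \<one>"
proof -
  obtain j k where "x [^] (p ^ j) = \<one>" "x [^] (q ^ k) = \<one>" "x \<in> carrier G"
    using assms(4,5) by (auto simp: primary_elements_def)
  moreover have "coprime (p ^ j) (q ^ k)"
    using assms(1-3) by (simp add: primes_coprime)
  ultimately show ?thesis using pow_coprime_eq_one by blast
qed

text \<open>
  The image of \<open>x\<close> in the quotient of the normalizer by \<open>H\<close> has \<open>p\<close>-power order, whereas the order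
  of that quotient is prime to \<open>p\<close> because \<open>H\<close> already accounts for the full power of \<open>p\<close>. So the
  image is trivial.
\<close>

lemma (in group) primary_mem_if_normalizes:
  assumes fin: "finite (carrier G)" and p: "prime p"
    and H: "subgroup H G" and card: "p ^ multiplicity p (order G) dvd card H"
    and x: "x \<in> primary_elements G p" "x \<in> normalizer G H"
  shows "x \<in> H"
proof -
  define K where "K = normalizer G H"
  define GK where "GK = G\<lparr>carrier := K\<rparr>"
  have K: "subgroup K G" unfolding K_def by (rule normalizer_imp_subgroup[OF subgroup.subset[OF H]])
  have n: "H \<lhd> GK" unfolding GK_def K_def by (rule subgroup_in_normalizer[OF H])
  interpret n: normal H GK by (rule n)
  interpret Q: group "GK Mod H" by (rule n.factorgroup_is_group)
  interpret h: group_hom GK "GK Mod H" "\<lambda>a. H #>\<^bsub>GK\<^esub> a"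
    by unfold_locales (rule n.r_coset_hom_Mod)
  define m where "m = order (GK Mod H)"
  have "m * card H = card K"
    using n.lagrange[OF n.subgroup_axioms] by (simp add: m_def order_def FactGroup_def GK_def)
  moreover have "card K dvd order G" using card_subgroup_dvd[OF K subgroup_self subgroup.subset[OF K]] by (simp add: order_def)
  ultimately have mH: "m * card H dvd order G" by simp
  have o: "order G \<noteq> 0" using fin using order_gt_0_iff_finite by simp
  have "\<not> p dvd m"
  proof
    assume "p dvd m"
    then have "p * p ^ multiplicity p (order G) dvd m * card H" using card mult_dvd_mono by blast
    then have "p ^ Suc (multiplicity p (order G)) dvd order G" using mH by auto
    then have "Suc (multiplicity p (order G)) \<le> multiplicity p (order G)"
      using o p by (intro multiplicity_geI) (auto dest: not_prime_unit)
    then show False by simp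
  qed
  then have cop: "coprime (p ^ k) m" for k using p by (simp add: prime_imp_coprime)
  have xK: "x \<in> carrier GK" using x by (simp add: GK_def K_def)
  obtain k where k: "x [^] (p ^ k) = \<one>" using x by (auto simp: primary_elements_def)
  have "x [^]\<^bsub>GK\<^esub> (p ^ k) = \<one>\<^bsub>GK\<^esub>"
    using k by (simp add: GK_def nat_pow_consistent[symmetric])
  then have "(H #>\<^bsub>GK\<^esub> x) [^]\<^bsub>GK Mod H\<^esub> (p ^ k) = \<one>\<^bsub>GK Mod H\<^esub>"
    using h.hom_nat_pow[OF xK, of "p ^ k"] h.hom_one by simp
  moreover have "(H #>\<^bsub>GK\<^esub> x) [^]\<^bsub>GK Mod H\<^esub> m = \<one>\<^bsub>GK Mod H\<^esub>"
    using Q.pow_order_eq_1 h.hom_closed[OF xK] by (simp add: m_def)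
  ultimately have "H #>\<^bsub>GK\<^esub> x = \<one>\<^bsub>GK Mod H\<^esub>"
    using Q.pow_coprime_eq_one h.hom_closed[OF xK] cop by blast
  then have "H #>\<^bsub>GK\<^esub> x = H" by (simp add: FactGroup_def)
  then show ?thesis using n.rcos_self[OF xK n.subgroup_axioms] by simp
qed

lemma (in group) exists_sylow_subgroup:
  assumes "finite (carrier G)" "prime p"
  obtains Q where "subgroup Q G" "card Q = p ^ multiplicity p (order G)"
proof -
  obtain m where "order G = p ^ multiplicity p (order G) * m"
    using multiplicity_dvd by blast
  then show ?thesis using sylow_thm[OF assms(2) is_group _ assms(1)] that by blast
qed

text \<open>
  Otherwise every Sylow subgroup of \<open>K\<close> would lie in \<open>U\<close>, and the order of \<open>K\<close> would divide
  that of \<open>U\<close>.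
\<close>

lemma (in group) exists_primary_outside:
  assumes fin: "finite (carrier G)" and K: "subgroup K G" and U: "subgroup U G" "U \<subset> K"
  obtains p x where "prime p" "x \<in> primary_elements G p" "x \<in> K" "x \<notin> U"
proof -
  interpret K: group "G\<lparr>carrier := K\<rparr>" by (rule subgroup_imp_group[OF K])
  have finK: "finite K" using fin K subgroup.subset finite_subset by blast
  have "\<exists>p. prime p \<and> \<not> p ^ multiplicity p (card K) dvd card U"
  proof (rule ccontr)
    assume "\<not> ?thesis"
    moreover have "card K \<noteq> 0" using finK subgroup.one_closed[OF K] by auto
    ultimately have "card K dvd card U" using dvd_if_prime_parts_dvd by blast
    moreover have "card U > 0" 
      using finite_subset[of U K] finK U(2) subgroup.one_closed[OF U(1)] by (auto simp: card_gt_0_iff)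
    ultimately have "card K \<le> card U" by (rule dvd_imp_le)
    then show False using psubset_card_mono[OF finK U(2)] by simp
  qed
  then obtain p where p: "prime p" "\<not> p ^ multiplicity p (card K) dvd card U" by blast
  obtain Q where Q: "subgroup Q (G\<lparr>carrier := K\<rparr>)" "card Q = p ^ multiplicity p (card K)"
    using K.exists_sylow_subgroup[of p] finK p by (auto simp: order_def)
  have QG: "subgroup Q G" using Q(1) K incl_subgroup by blast
  have QK: "Q \<subseteq> K" using subgroup.subset[OF Q(1)] by simp
  have "\<not> Q \<subseteq> U" using card_subgroup_dvd[OF QG U(1)] p Q by auto
  then obtain x where "x \<in> Q" "x \<notin> U" by blast
  moreover have "Q \<subseteq> primary_elements G p"
    using prime_power_subgroup_subset_primary[OF QG Q(2)] finK QK finite_subset by blast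
  ultimately show ?thesis using that p QK by blast
qed

section \<open>Sylow subgroups of finite nilpotent groups\<close>

lemma (in group) subgroup_subset_normalizer:
  assumes "subgroup H G"
  shows "H \<subseteq> normalizer G H"
proof
  interpret H: subgroup H G by (rule assms)
  fix x assume x: "x \<in> H"
  have xc: "x \<in> carrier G" using x by simp
  show "x \<in> normalizer G H"
    unfolding normalizer_iff[OF H.subset]
  proof (intro conjI ballI iffI xc)
    fix u assume u: "u \<in> carrier G" and v: "x \<otimes> u \<otimes> inv x \<in> H"
    have "inv x \<otimes> (x \<otimes> u \<otimes> inv x) \<otimes> x \<in> H"
      by (intro H.m_closed H.m_inv_closed x v)
    then show "u \<in> H" using u xc by (simp add: m_assoc inv_mult_cancel)
  next
    fix u assume "u \<in> H"
    then show "x \<otimes> u \<otimes> inv x \<in> H" by (intro H.m_closed H.m_inv_closed x)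
  qed
qed

text \<open>
  At the last step of the lower central series not contained in \<open>H\<close>, every element normalizes \<open>H\<close>,
  since its commutators with arbitrary elements fall into the next step, hence into \<open>H\<close>.
\<close>

lemma (in group) nilpotent_normalizer_grows:
  assumes nil: "nilpotent_group G" and H: "subgroup H G" "H \<noteq> carrier G"
  shows "H \<subset> normalizer G H"
proof -
  interpret H: subgroup H G by (rule H)
  obtain n where n: "lower_central G n = {\<one>}" using nil by (auto simp: nilpotent_group_def)
  have sub: "lower_central G i \<subseteq> carrier G" for i
  proof (induction i)
    case (Suc i)
    then show ?case unfolding lower_central.simps by (intro generate_incl) auto
  qed simp
  have "\<exists>i. \<not> lower_central G i \<subseteq> H \<and> lower_central G (Suc i) \<subseteq> H"
  proof (rule ccontr)
    assume no: "\<not> ?thesis"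
    have "\<not> lower_central G i \<subseteq> H" for i
    proof (induction i)
      case 0
      then show ?case using H(2) H.subset by auto
    next
      case (Suc i)
      then show ?case using no by blast
    qed
    then show False using n H.one_closed by force
  qed
  then obtain i where i: "\<not> lower_central G i \<subseteq> H" "lower_central G (Suc i) \<subseteq> H" by blast
  then obtain g where g: "g \<in> lower_central G i" "g \<notin> H" by blast
  then have gc: "g \<in> carrier G" using sub by blast
  have comm: "u \<otimes> g \<otimes> inv u \<otimes> inv g \<in> H" if "u \<in> carrier G" for u
  proof -
    have "u \<otimes> g \<otimes> inv u \<otimes> inv g \<in> lower_central G (Suc i)"
      unfolding lower_central.simps using that g by (intro generate.incl) blast
    then show ?thesis using i by blast
  qed
  \<comment> \<open>The commutator of \<open>u\<close> and \<open>g\<close> is \<open>u\<close> times the inverse of the conjugate of \<open>u\<close> by \<open>g\<close>;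
    as it lies in \<open>H\<close>, one of these factors is in \<open>H\<close> if and only if the other is.\<close>
  have "g \<in> normalizer G H"
    unfolding normalizer_iff[OF H.subset]
  proof (intro conjI ballI gc)
    fix u assume u: "u \<in> carrier G"
    have eq: "u \<otimes> g \<otimes> inv u \<otimes> inv g = u \<otimes> inv (g \<otimes> u \<otimes> inv g)"
      using u gc by (simp add: inv_mult_group m_assoc)
    show "g \<otimes> u \<otimes> inv g \<in> H \<longleftrightarrow> u \<in> H" (is "?v \<in> H \<longleftrightarrow> _")
    proof
      assume "?v \<in> H"
      from H.m_closed[OF comm[OF u] this] have "(u \<otimes> inv ?v) \<otimes> ?v \<in> H" by (simp only: eq)
      then show "u \<in> H" using u gc by (simp add: m_assoc inv_mult_cancel)
    next
      assume "u \<in> H"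
      from H.m_closed[OF H.m_inv_closed[OF comm[OF u]] this]
      have "inv (u \<otimes> inv ?v) \<otimes> u \<in> H" by (simp only: eq)
      then show "?v \<in> H" using u gc by (simp add: inv_mult_group m_assoc inv_mult_cancel)
    qed
  qed
  then show ?thesis using g(2) subgroup_subset_normalizer[OF H(1)] by blast
qed

text \<open>
  A Sylow subgroup \<open>Q\<close> contains every element \<open>x\<close> of \<open>p\<close>-power order: if not, let \<open>H\<close> be maximal among
  the subgroups that contain \<open>Q\<close> but not \<open>x\<close>. Normalizers grow, so \<open>x\<close> normalizes \<open>H\<close> by
  maximality; as \<open>H\<close> contains \<open>Q\<close>, this forces \<open>x\<close> into \<open>H\<close>.
\<close>

lemma (in group) nilpotent_primary_sylow:
  assumes nil: "nilpotent_group G" and fin: "finite (carrier G)" and p: "prime p"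
  shows "subgroup (primary_elements G p) G"
    and "card (primary_elements G p) = p ^ multiplicity p (order G)"
proof -
  obtain Q where Q: "subgroup Q G" "card Q = p ^ multiplicity p (order G)"
    by (rule exists_sylow_subgroup[OF fin p])
  have "primary_elements G p \<subseteq> Q"
  proof
    fix x assume x: "x \<in> primary_elements G p"
    show "x \<in> Q"
    proof (rule ccontr)
      assume "x \<notin> Q"
      define F where "F = {H. subgroup H G \<and> Q \<subseteq> H \<and> x \<notin> H}"
      have "F \<subseteq> Pow (carrier G)" using subgroup.subset by (auto simp: F_def)
      then have "finite F" using fin by (meson finite_Pow_iff finite_subset)
      moreover have "Q \<in> F" using Q \<open>x \<notin> Q\<close> by (auto simp: F_def)
      ultimately obtain H where H: "H \<in> F" "\<And>H'. H' \<in> F \<Longrightarrow> H \<subseteq> H' \<Longrightarrow> H' = H"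
        using finite_has_maximal[of F] by blast
      have HG: "subgroup H G" "Q \<subseteq> H" "x \<notin> H" using H(1) by (auto simp: F_def)
      have "H \<noteq> carrier G" using HG(3) x by (auto simp: primary_elements_def)
      then have N: "H \<subset> normalizer G H" by (rule nilpotent_normalizer_grows[OF nil HG(1)])
      have "normalizer G H \<notin> F" using H(2) N by blast
      then have "x \<in> normalizer G H"
        using N HG normalizer_imp_subgroup[OF subgroup.subset[OF HG(1)]] by (auto simp: F_def)
      moreover have "p ^ multiplicity p (order G) dvd card H"
        using card_subgroup_dvd[OF Q(1) HG(1,2)] Q(2) by simp
      ultimately have "x \<in> H" using primary_mem_if_normalizes[OF fin p HG(1) _ x] by blast
      then show False using HG by blast
    qed
  qed
  moreover have "Q \<subseteq> primary_elements G p"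
    using prime_power_subgroup_subset_primary[OF Q] finite_subset[OF subgroup.subset[OF Q(1)] fin] .
  ultimately have "primary_elements G p = Q" by blast
  then show "subgroup (primary_elements G p) G"
    "card (primary_elements G p) = p ^ multiplicity p (order G)" using Q by auto
qed

lemma (in group) pow_conj:
  assumes "g \<in> carrier G" "x \<in> carrier G"
  shows "(g \<otimes> x \<otimes> inv g) [^] (n::nat) = g \<otimes> x [^] n \<otimes> inv g"
proof (induction n)
  case 0
  show ?case using assms by simp
next
  case (Suc n)
  have "(g \<otimes> x \<otimes> inv g) [^] Suc n = (g \<otimes> x [^] n \<otimes> inv g) \<otimes> (g \<otimes> x \<otimes> inv g)"
    by (simp only: nat_pow_Suc Suc)
  also have "\<dots> = g \<otimes> x [^] Suc n \<otimes> inv g"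
    using assms by (simp add: m_assoc inv_mult_cancel)
  finally show ?case .
qed

text \<open>
  The commutator of \<open>x\<close> and \<open>y\<close> belongs to both normal subgroups of primary elements, which meet
  trivially.
\<close>

lemma (in group) nilpotent_primary_commute:
  assumes nil: "nilpotent_group G" and fin: "finite (carrier G)"
    and p: "prime p" and q: "prime q" and "p \<noteq> q"
    and x: "x \<in> primary_elements G p" and y: "y \<in> primary_elements G q"
  shows "x \<otimes> y = y \<otimes> x"
proof -
  interpret P: subgroup "primary_elements G p" G by (rule nilpotent_primary_sylow[OF nil fin p])
  interpret Q: subgroup "primary_elements G q" G by (rule nilpotent_primary_sylow[OF nil fin q])
  have c: "x \<in> carrier G" "y \<in> carrier G" using x y by auto
  have conj: "g \<otimes> z \<otimes> inv g \<in> primary_elements G r"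
    if g: "g \<in> carrier G" and z: "z \<in> primary_elements G r" for g z r
  proof -
    obtain k where k: "z [^] (r ^ k) = \<one>" and zc: "z \<in> carrier G"
      using z unfolding primary_elements_def by blast
    show ?thesis
    proof (rule primary_elementsI)
      show "g \<otimes> z \<otimes> inv g \<in> carrier G" using g zc by simp
      show "(g \<otimes> z \<otimes> inv g) [^] (r ^ k) = \<one>"
        unfolding pow_conj[OF g zc] k using g by simp
    qed
  qed
  define w where "w = x \<otimes> y \<otimes> inv x \<otimes> inv y"
  have wq: "w \<in> primary_elements G q"
    unfolding w_def by (rule Q.m_closed[OF conj[OF c(1) y] Q.m_inv_closed[OF y]])
  have "w = x \<otimes> (y \<otimes> inv x \<otimes> inv y)"
    unfolding w_def using c by (simp add: m_assoc)
  then have "w \<in> primary_elements G p"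
    using P.m_closed[OF x conj[OF c(2) P.m_inv_closed[OF x]]] by simp
  then have "w = \<one>" using primary_elements_Int[OF p q \<open>p \<noteq> q\<close> _ wq] by simp
  have "x \<otimes> y = w \<otimes> (y \<otimes> x)"
    unfolding w_def using c by (simp add: m_assoc inv_mult_cancel)
  also have "\<dots> = y \<otimes> x" using \<open>w = \<one>\<close> c by simp
  finally show ?thesis .
qed

section \<open>Fixed points of actions with prime power orbits\<close>

text \<open>
  The hypothesis on the sets \<open>S\<close> says that the group acts as a \<open>p\<close>-group would: a stabilizer
  contains a Sylow \<open>q\<close>-subgroup for every prime \<open>q \<noteq> p\<close>, so that no such \<open>q\<close> divides the length of an
  orbit. Orbits of length greater than one thus have length divisible by \<open>p\<close>, and the number of
  fixed points is divisible by \<open>p\<close> because the number of all points is; so \<open>e\<close> cannot be the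
  only one.
\<close>

lemma (in group_action) exists_second_fixed_point:
  assumes fin: "finite (carrier G)" and finE: "finite E" and p: "prime p" and card: "p dvd card E"
    and e: "e \<in> E" and fix_e: "\<And>g. g \<in> carrier G \<Longrightarrow> \<phi> g e = e"
    and triv: "\<And>q. prime q \<Longrightarrow> q \<noteq> p \<Longrightarrow> \<exists>S. subgroup S G \<and>
      card S = q ^ multiplicity q (order G) \<and> (\<forall>g \<in> S. \<forall>x \<in> E. \<phi> g x = x)"
  shows "\<exists>x \<in> E. x \<noteq> e \<and> (\<forall>g \<in> carrier G. \<phi> g x = x)"
proof (rule ccontr)
  assume no: "\<not> ?thesis"
  interpret G: group G using group_hom by (simp add: group_hom_def)
  have orb_sub: "orbit G \<phi> x \<subseteq> E" if "x \<in> E" for x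
    using that element_image by (auto simp: orbit_def)
  have dvd_orb: "p dvd card (orbit G \<phi> x)" if x: "x \<in> E" "x \<noteq> e" for x
  proof (rule ccontr)
    assume np: "\<not> p dvd card (orbit G \<phi> x)"
    have st: "subgroup (stabilizer G \<phi> x) G" by (rule stabilizer_subgroup[OF x(1)])
    have os: "card (orbit G \<phi> x) * card (stabilizer G \<phi> x) = order G"
      by (rule orbit_stabilizer_theorem[OF x(1)])
    obtain g where g: "g \<in> carrier G" "\<phi> g x \<noteq> x" using no x by blast
    have in1: "x \<in> orbit G \<phi> x" by (rule orbit_refl[OF x(1)])
    have in2: "\<phi> g x \<in> orbit G \<phi> x" using g(1) unfolding orbit_def by blast
    have "card (orbit G \<phi> x) \<noteq> 1"
      using in1 in2 g(2) by (auto simp: card_1_singleton_iff)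
    then obtain q where q: "prime q" "q dvd card (orbit G \<phi> x)"
      using prime_factor_nat by blast
    then have "q \<noteq> p" using np by blast
    then obtain S where S: "subgroup S G" "card S = q ^ multiplicity q (order G)"
      "\<forall>g \<in> S. \<forall>x \<in> E. \<phi> g x = x" using triv q(1) by blast
    have "S \<subseteq> stabilizer G \<phi> x"
      using S(3) x(1) subgroup.subset[OF S(1)] by (auto simp: stabilizer_def)
    then have "card S dvd card (stabilizer G \<phi> x)"
      by (rule G.card_subgroup_dvd[OF S(1) st])
    then have "q * q ^ multiplicity q (order G) dvd order G"
      using mult_dvd_mono[OF q(2)] S(2) os by metis
    then have "q ^ Suc (multiplicity q (order G)) dvd order G" by simp
    moreover have "order G \<noteq> 0" using G.order_gt_0_iff_finite fin by simp
    ultimately have "Suc (multiplicity q (order G)) \<le> multiplicity q (order G)"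
      using q(1) by (intro multiplicity_geI) (auto dest: not_prime_unit)
    then show False by simp
  qed
  define C where "C = orbits G E \<phi> - {orbit G \<phi> e}"
  have orb_e: "orbit G \<phi> e = {e}"
    using fix_e orbit_refl[OF e] by (auto simp: orbit_def)
  have union: "\<Union> (orbits G E \<phi>) = E"
    using orb_sub orbit_refl by (auto simp: orbits_def)
  have disj: "c1 \<inter> c2 = {}" if "c1 \<in> orbits G E \<phi>" "c2 \<in> orbits G E \<phi>" "c1 \<noteq> c2" for c1 c2
    using disjoint_union that by blast
  have e_orb: "{e} \<in> orbits G E \<phi>" using e orb_e by (auto simp: orbits_def)
  have UC: "\<Union> C = E - {e}"
  proof
    show "\<Union> C \<subseteq> E - {e}"
      using disj[OF _ e_orb] union unfolding C_def orb_e by blast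
    show "E - {e} \<subseteq> \<Union> C"
      using union unfolding C_def orb_e by blast
  qed
  have "p dvd card (\<Union> C)"
  proof (rule dvd_partition)
    show "finite (\<Union> C)" unfolding UC using finE by simp
    show "\<forall>c1\<in>C. \<forall>c2\<in>C. c1 \<noteq> c2 \<longrightarrow> c1 \<inter> c2 = {}" using disj unfolding C_def by blast
    show "\<forall>c\<in>C. p dvd card c"
    proof
      fix c assume "c \<in> C"
      then obtain x where "x \<in> E" "c = orbit G \<phi> x" "c \<noteq> orbit G \<phi> e"
        unfolding C_def orbits_def by blast
      then show "p dvd card c" using dvd_orb by blast
    qed
  qed
  then have "p dvd card E - 1" unfolding UC using e finE by simp
  moreover have "card E > 0" using e finE by (auto simp: card_gt_0_iff)
  ultimately have "p dvd 1" using card by (metis Suc_pred' One_nat_def dvd_diffD1 Suc_leI)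
  then show False using p by (auto dest: not_prime_unit)
qed

section \<open>Groups acting by automorphisms\<close>

locale automorphism_action = N: group N + A: group A
  for N (structure) and A and \<phi> +
  assumes closed: "\<lbrakk>a \<in> carrier A; x \<in> carrier N\<rbrakk> \<Longrightarrow> \<phi> a x \<in> carrier N"
    and mult: "\<lbrakk>a \<in> carrier A; x \<in> carrier N; y \<in> carrier N\<rbrakk> \<Longrightarrow> \<phi> a (x \<otimes> y) = \<phi> a x \<otimes> \<phi> a y"
    and comp: "\<lbrakk>a \<in> carrier A; b \<in> carrier A; x \<in> carrier N\<rbrakk> \<Longrightarrow> \<phi> (a \<otimes>\<^bsub>A\<^esub> b) x = \<phi> a (\<phi> b x)"
    and act_one: "x \<in> carrier N \<Longrightarrow> \<phi> \<one>\<^bsub>A\<^esub> x = x"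
begin

lemma act_of_one: "a \<in> carrier A \<Longrightarrow> \<phi> a \<one> = \<one>"
  using mult[of a \<one> \<one>] closed[of a \<one>] N.l_cancel_one'[of "\<phi> a \<one>" "\<phi> a \<one>"] by simp

lemma act_inv: "\<lbrakk>a \<in> carrier A; x \<in> carrier N\<rbrakk> \<Longrightarrow> \<phi> a (inv x) = inv (\<phi> a x)"
  using mult[of a "inv x" x] act_of_one by (intro N.inv_equality[symmetric]) (auto simp: closed)

lemma inv_act:
  "\<lbrakk>a \<in> carrier A; x \<in> carrier N\<rbrakk> \<Longrightarrow> \<phi> (inv\<^bsub>A\<^esub> a) (\<phi> a x) = x"
  "\<lbrakk>a \<in> carrier A; x \<in> carrier N\<rbrakk> \<Longrightarrow> \<phi> a (\<phi> (inv\<^bsub>A\<^esub> a) x) = x"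
  by (simp_all add: comp[symmetric] act_one)

lemma pow: "\<lbrakk>a \<in> carrier A; x \<in> carrier N\<rbrakk> \<Longrightarrow> \<phi> a (x [^] (n::nat)) = \<phi> a x [^] n"
  by (induction n) (auto simp: act_of_one mult)

definition invariant :: "'a set \<Rightarrow> bool" where
  "invariant U \<longleftrightarrow> (\<forall>a \<in> carrier A. \<forall>x \<in> U. \<phi> a x \<in> U)"

lemma primary_elements_invariant: "invariant (primary_elements N p)"
  unfolding invariant_def
proof (intro ballI)
  fix a x assume a: "a \<in> carrier A" and "x \<in> primary_elements N p"
  then obtain k where x: "x \<in> carrier N" "x [^] (p ^ k) = \<one>" by (auto simp: primary_elements_def)
  show "\<phi> a x \<in> primary_elements N p"
    using a x by (intro primary_elementsI[where k = k]) (simp_all add: closed act_of_one flip: pow)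
qed

lemma act_r_coset:
  assumes V: "subgroup V N" "invariant V" and a: "a \<in> carrier A" and x: "x \<in> carrier N"
  shows "\<phi> a ` (V #> x) = V #> \<phi> a x"
proof -
  have Vc: "V \<subseteq> carrier N" by (rule subgroup.subset[OF V(1)])
  have "\<phi> a ` V = V"
  proof
    show "\<phi> a ` V \<subseteq> V" using V(2) a by (auto simp: invariant_def)
    show "V \<subseteq> \<phi> a ` V"
    proof
      fix v assume v: "v \<in> V"
      have "\<phi> (inv\<^bsub>A\<^esub> a) v \<in> V" using V(2) a v by (simp add: invariant_def)
      moreover have "v = \<phi> a (\<phi> (inv\<^bsub>A\<^esub> a) v)" using inv_act(2)[OF a] v Vc by auto
      ultimately show "v \<in> \<phi> a ` V" by blast
    qed
  qed
  moreover have "\<phi> a ` (V #> x) = \<phi> a ` V #> \<phi> a x"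
    using Vc a x by (force simp: r_coset_def mult)
  ultimately show ?thesis by simp
qed

text \<open>
  The permutation action to which the fixed point count is applied. Right cosets by elements of
  \<open>W\<close> suffice, as fixed points inside a \<open>p\<close>-group are sought.
\<close>

lemma coset_action:
  assumes V: "subgroup V N" "invariant V" and W: "W \<subseteq> carrier N" "invariant W"
  shows "group_action A ((\<lambda>w. V #> w) ` W) (\<lambda>a. \<lambda>C \<in> (\<lambda>w. V #> w) ` W. \<phi> a ` C)"
    (is "group_action A ?E ?\<psi>")
proof -
  have cos: "\<phi> a ` (V #> w) = V #> \<phi> a w" if "a \<in> carrier A" "w \<in> W" for a w
    using act_r_coset[OF V] that W(1) by blast
  have map: "\<phi> a ` C \<in> ?E" if "a \<in> carrier A" "C \<in> ?E" for a C
    using that W(2) by (auto simp: cos invariant_def)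
  have sub: "C \<subseteq> carrier N" if "C \<in> ?E" for C
    using that W(1) N.r_coset_subset_G[OF subgroup.subset[OF V(1)]] by blast
  have comp': "\<phi> (a \<otimes>\<^bsub>A\<^esub> b) ` C = \<phi> a ` \<phi> b ` C"
    if "a \<in> carrier A" "b \<in> carrier A" "C \<in> ?E" for a b C
    using sub[OF that(3)] that(1,2) by (auto simp: image_image comp subset_iff intro!: image_cong)
  have one': "\<phi> \<one>\<^bsub>A\<^esub> ` C = C" if "C \<in> ?E" for C
    using sub[OF that] by (auto simp: act_one subset_iff image_iff)
  have bij: "?\<psi> a \<in> Bij ?E" if a: "a \<in> carrier A" for a
  proof -
    have "bij_betw (?\<psi> a) ?E ?E"
    proof (rule bij_betw_byWitness[where f' = "?\<psi> (inv\<^bsub>A\<^esub> a)"])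
      show "\<forall>C\<in>?E. ?\<psi> (inv\<^bsub>A\<^esub> a) (?\<psi> a C) = C"
        using a map one' by (simp add: comp'[symmetric] del: image_iff)
      show "\<forall>C\<in>?E. ?\<psi> a (?\<psi> (inv\<^bsub>A\<^esub> a) C) = C"
        using a map one' by (simp add: comp'[symmetric] del: image_iff)
      show "?\<psi> a ` ?E \<subseteq> ?E" using a map by auto
      show "?\<psi> (inv\<^bsub>A\<^esub> a) ` ?E \<subseteq> ?E" using a map by auto
    qed
    then show ?thesis by (simp add: Bij_def)
  qed
  have "?\<psi> \<in> hom A (BijGroup ?E)"
  proof (rule homI)
    fix a assume "a \<in> carrier A"
    then show "?\<psi> a \<in> carrier (BijGroup ?E)" using bij by (simp add: BijGroup_def)
  next
    fix a b assume a: "a \<in> carrier A" and b: "b \<in> carrier A"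
    have "?\<psi> (a \<otimes>\<^bsub>A\<^esub> b) = compose ?E (?\<psi> a) (?\<psi> b)"
      unfolding compose_def using a b map comp' by (intro restrict_ext) simp
    then show "?\<psi> (a \<otimes>\<^bsub>A\<^esub> b) = ?\<psi> a \<otimes>\<^bsub>BijGroup ?E\<^esub> ?\<psi> b"
      using bij a b by (simp add: BijGroup_def)
  qed
  then show ?thesis
    unfolding group_action_def group_hom_def group_hom_axioms_def
    using A.is_group group_BijGroup by blast
qed

text \<open>
  The group \<open>A\<close> acts on the cosets of \<open>V\<close> in \<open>W\<close>. Their number is a power of \<open>p\<close> other than
  \<open>1\<close>, and \<open>V\<close> itself is fixed, so some other coset is fixed as well.
\<close>

lemma exists_fixed_modulo:
  assumes fin: "finite (carrier A)" and p: "prime p"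
    and W: "subgroup W N" "card W = p ^ k" "finite W" "invariant W"
    and V: "subgroup V N" "V \<subset> W" "invariant V"
    and triv: "\<And>q. prime q \<Longrightarrow> q \<noteq> p \<Longrightarrow> \<exists>S. subgroup S A \<and>
      card S = q ^ multiplicity q (order A) \<and> (\<forall>a \<in> S. \<forall>w \<in> W. \<phi> a w = w)"
  shows "\<exists>w \<in> W - V. \<forall>a \<in> carrier A. \<phi> a w \<otimes> inv w \<in> V"
proof -
  let ?E = "(\<lambda>w. V #> w) ` W"
  let ?\<psi> = "\<lambda>a. \<lambda>C \<in> ?E. \<phi> a ` C"
  have Wc: "W \<subseteq> carrier N" by (rule subgroup.subset[OF W(1)])
  interpret act: group_action A ?E ?\<psi> by (rule coset_action[OF V(1,3) Wc W(4)])
  interpret W: group "N\<lparr>carrier := W\<rparr>" by (rule N.subgroup_imp_group[OF W(1)])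
  have VW: "subgroup V (N\<lparr>carrier := W\<rparr>)"
    using N.subgroup_incl[OF V(1) W(1)] V(2) by blast
  have one_W: "\<one> \<in> W" by (rule subgroup.one_closed[OF W(1)])
  have coset_one: "V #> \<one> = V" using N.coset_mult_one subgroup.subset[OF V(1)] by blast
  have "rcosets\<^bsub>N\<lparr>carrier := W\<rparr>\<^esub> V = ?E"
    by (auto simp: RCOSETS_def r_coset_def)
  then have lag: "card ?E * card V = p ^ k"
    using W.lagrange[OF VW] W(2) by (simp add: order_def)
  have "card V \<noteq> card W" using psubset_card_mono[OF W(3) V(2)] by simp
  then have "card ?E \<noteq> 1" using lag W(2) by auto
  moreover obtain j where "card ?E = p ^ j"
    using lag p divides_primepow_nat[of p "card ?E" k] by (metis dvd_triv_left)
  ultimately have dvd: "p dvd card ?E" by (cases j) auto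
  have V_E: "V \<in> ?E" using one_W coset_one by force
  have "\<exists>C \<in> ?E. C \<noteq> V \<and> (\<forall>a \<in> carrier A. ?\<psi> a C = C)"
  proof (rule act.exists_second_fixed_point[OF fin _ p dvd V_E])
    show "finite ?E" using W(3) by simp
    show "?\<psi> a V = V" if a: "a \<in> carrier A" for a
      using act_r_coset[OF V(1,3) a N.one_closed] V_E act_of_one[OF a] coset_one by simp
    fix q :: nat assume "prime q" "q \<noteq> p"
    then obtain S where S: "subgroup S A" "card S = q ^ multiplicity q (order A)"
      "\<forall>a \<in> S. \<forall>w \<in> W. \<phi> a w = w" using triv by blast
    have "?\<psi> a C = C" if a: "a \<in> S" and C: "C \<in> ?E" for a C
    proof -
      obtain w where w: "w \<in> W" "C = V #> w" using C by blast
      have "\<phi> a ` C = V #> \<phi> a w"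
        unfolding w(2) using act_r_coset[OF V(1,3)] a w(1) Wc subgroup.subset[OF S(1)] by blast
      then show ?thesis using S(3) a C w by simp
    qed
    then show "\<exists>S. subgroup S A \<and> card S = q ^ multiplicity q (order A) \<and>
        (\<forall>g\<in>S. \<forall>x\<in>?E. ?\<psi> g x = x)" using S by blast
  qed
  then obtain w where w: "w \<in> W" "V #> w \<noteq> V"
    and fixed: "\<And>a. a \<in> carrier A \<Longrightarrow> \<phi> a ` (V #> w) = V #> w" by auto
  have wc: "w \<in> carrier N" using w(1) Wc by blast
  have "w \<notin> V" using w(2) N.coset_join2[OF wc V(1)] by blast
  moreover have "\<phi> a w \<otimes> inv w \<in> V" if a: "a \<in> carrier A" for a
  proof -
    have "\<phi> a w \<in> V #> w"
      using fixed[OF a] N.rcos_self[OF wc V(1)] by blast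
    then obtain v where "v \<in> V" "\<phi> a w = v \<otimes> w" by (auto simp: r_coset_def)
    then show ?thesis using wc subgroup.subset[OF V(1)] by (auto simp: N.m_assoc subset_iff)
  qed
  ultimately show ?thesis using w(1) by blast
qed

end

section \<open>The displacement series of an action\<close>

text \<open>
  Both series of interest are of this form: the left series of a brace arises from the action
  \<open>\<lambda>\<close> of the multiplicative on the additive group, and the lower central series of a group from
  its action on itself by conjugation. Only subgroups generated by displacements \<open>\<phi> a x - x\<close> are
  formed; in general the terms are not normal.
\<close>

primrec displacement_series ::
    "('a, 'm) monoid_scheme \<Rightarrow> ('g, 'n) monoid_scheme \<Rightarrow> ('g \<Rightarrow> 'a \<Rightarrow> 'a) \<Rightarrow> nat \<Rightarrow> 'a set" where
  "displacement_series N A \<phi> 0 = carrier N"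
| "displacement_series N A \<phi> (Suc n) =
     generate N (\<Union>a \<in> carrier A. \<Union>x \<in> displacement_series N A \<phi> n. {\<phi> a x \<otimes>\<^bsub>N\<^esub> inv\<^bsub>N\<^esub> x})"

context automorphism_action
begin

lemma act_displacement:
  assumes "a \<in> carrier A" "b \<in> carrier A" "x \<in> carrier N"
  shows "\<phi> b (\<phi> a x \<otimes> inv x) = \<phi> (b \<otimes>\<^bsub>A\<^esub> a \<otimes>\<^bsub>A\<^esub> inv\<^bsub>A\<^esub> b) (\<phi> b x) \<otimes> inv (\<phi> b x)"
  using assms by (simp add: mult closed act_inv comp inv_act)

lemma generate_invariant:
  assumes S: "S \<subseteq> carrier N" "invariant S"
  shows "invariant (generate N S)"
  unfolding invariant_def
proof (intro ballI)
  fix a x assume a: "a \<in> carrier A" and "x \<in> generate N S"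
  from this(2) show "\<phi> a x \<in> generate N S"
  proof (induction rule: generate.induct)
    case one
    then show ?case using act_of_one[OF a] by (simp add: generate.one)
  next
    case (incl h)
    then show ?case using S(2) a by (auto simp: invariant_def intro: generate.incl)
  next
    case (inv h)
    then have "\<phi> a (inv h) = inv (\<phi> a h)" using S(1) a by (auto simp: act_inv)
    then show ?case using S(2) a inv by (auto simp: invariant_def intro: generate.inv)
  next
    case (eng h1 h2)
    then have "\<phi> a (h1 \<otimes> h2) = \<phi> a h1 \<otimes> \<phi> a h2"
      using N.generate_in_carrier[OF S(1)] a by (simp add: mult)
    then show ?case using eng generate.eng by metis
  qed
qed

lemma displacement_series_subgroup:
  "subgroup (displacement_series N A \<phi> n) N \<and> invariant (displacement_series N A \<phi> n)"
proof (induction n)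
  case 0
  then show ?case by (auto simp: N.subgroup_self invariant_def closed)
next
  case (Suc n)
  let ?D = "displacement_series N A \<phi> n"
  let ?S = "\<Union>a \<in> carrier A. \<Union>x \<in> ?D. {\<phi> a x \<otimes> inv x}"
  have D: "?D \<subseteq> carrier N" using Suc subgroup.subset by blast
  have S: "?S \<subseteq> carrier N" using D closed by auto
  have "invariant ?S"
    unfolding invariant_def
  proof (intro ballI)
    fix b y assume b: "b \<in> carrier A" and "y \<in> ?S"
    then obtain a x where a: "a \<in> carrier A" "x \<in> ?D" "y = \<phi> a x \<otimes> inv x" by blast
    have "\<phi> b x \<in> ?D" using Suc a b by (auto simp: invariant_def)
    moreover have "b \<otimes>\<^bsub>A\<^esub> a \<otimes>\<^bsub>A\<^esub> inv\<^bsub>A\<^esub> b \<in> carrier A" using a b by simp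
    moreover have "\<phi> b y = \<phi> (b \<otimes>\<^bsub>A\<^esub> a \<otimes>\<^bsub>A\<^esub> inv\<^bsub>A\<^esub> b) (\<phi> b x) \<otimes> inv (\<phi> b x)"
      unfolding a(3) using a b D by (intro act_displacement) auto
    ultimately show "\<phi> b y \<in> ?S" by blast
  qed
  then show ?case
    unfolding displacement_series.simps
    using N.generate_is_subgroup[OF S] generate_invariant[OF S] by blast
qed

lemmas displacement_series_subset = subgroup.subset[OF displacement_series_subgroup[THEN conjunct1]]

lemma displacement_mem_series:
  assumes "a \<in> carrier A" "x \<in> displacement_series N A \<phi> n"
  shows "\<phi> a x \<otimes> inv x \<in> displacement_series N A \<phi> (Suc n)"
  unfolding displacement_series.simps using assms by (intro generate.incl) blast

lemma displacement_series_Suc_subset: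
  "displacement_series N A \<phi> (Suc n) \<subseteq> displacement_series N A \<phi> n"
proof -
  let ?D = "displacement_series N A \<phi> n"
  have D: "subgroup ?D N" "invariant ?D" using displacement_series_subgroup by blast+
  have "\<phi> a x \<otimes> inv x \<in> ?D" if "a \<in> carrier A" "x \<in> ?D" for a x
    using that D(2) subgroup.m_closed[OF D(1)] subgroup.m_inv_closed[OF D(1)]
    unfolding invariant_def by blast
  then show ?thesis
    unfolding displacement_series.simps by (intro N.generate_subgroup_incl D(1)) blast
qed

lemma displacement_series_antimono:
  "m \<le> n \<Longrightarrow> displacement_series N A \<phi> n \<subseteq> displacement_series N A \<phi> m"
  by (rule lift_Suc_antimono_le[of "displacement_series N A \<phi>", OF displacement_series_Suc_subset])

text \<open>
  A step of an ascending series that is to the displacement series what the upper central series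
  is to the lower one. The invariant subgroup \<open>U\<close> need not be normal, so the step is taken inside
  its normalizer; otherwise the result would not be a subgroup.
\<close>

definition fixed_modulo :: "'a set \<Rightarrow> 'a set" where
  "fixed_modulo U = {x \<in> normalizer N U. \<forall>a \<in> carrier A. \<phi> a x \<otimes> inv x \<in> U}"

lemma normalizer_invariant:
  assumes U: "U \<subseteq> carrier N" "invariant U"
  shows "invariant (normalizer N U)"
  unfolding invariant_def
proof (intro ballI)
  fix a x assume a: "a \<in> carrier A" and x: "x \<in> normalizer N U"
  have xc: "x \<in> carrier N" and n: "\<And>u. u \<in> carrier N \<Longrightarrow> x \<otimes> u \<otimes> inv x \<in> U \<longleftrightarrow> u \<in> U"
    using x unfolding N.normalizer_iff[OF U(1)] by auto
  have i: "\<phi> b u \<in> U \<longleftrightarrow> u \<in> U" if "b \<in> carrier A" "u \<in> carrier N" for b u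
    using U(2) inv_act(1)[OF that] that A.inv_closed unfolding invariant_def by metis
  have "\<phi> a x \<otimes> u \<otimes> inv (\<phi> a x) \<in> U \<longleftrightarrow> u \<in> U" if u: "u \<in> carrier N" for u
  proof -
    define v where "v = \<phi> (inv\<^bsub>A\<^esub> a) u"
    have v: "v \<in> carrier N" "u = \<phi> a v" using a u by (simp_all add: v_def closed inv_act)
    have "\<phi> a x \<otimes> u \<otimes> inv (\<phi> a x) = \<phi> a (x \<otimes> v \<otimes> inv x)"
      using a xc v by (simp add: mult act_inv closed)
    then show ?thesis using i[OF a, of "x \<otimes> v \<otimes> inv x"] i[OF a v(1)] n[OF v(1)] v xc by simp
  qed
  then show "\<phi> a x \<in> normalizer N U"
    unfolding N.normalizer_iff[OF U(1)] using closed[OF a xc] by blast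
qed

lemma fixed_modulo_subgroup:
  assumes U: "subgroup U N" "invariant U"
  shows "subgroup (fixed_modulo U) N" and "invariant (fixed_modulo U)" and "U \<subseteq> fixed_modulo U"
proof -
  interpret U: subgroup U N by (rule U(1))
  have Uc: "U \<subseteq> carrier N" by (rule U.subset)
  interpret M: subgroup "normalizer N U" N by (rule N.normalizer_imp_subgroup[OF Uc])
  have conj: "x \<otimes> u \<otimes> inv x \<in> U" if "x \<in> normalizer N U" "u \<in> U" for x u
    using that N.normalizer_iff[OF Uc] Uc by blast
  show sub: "U \<subseteq> fixed_modulo U"
  proof
    fix u assume u: "u \<in> U"
    have "\<phi> a u \<otimes> inv u \<in> U" if "a \<in> carrier A" for a
      using U(2) that u unfolding invariant_def by (intro U.m_closed U.m_inv_closed) auto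
    then show "u \<in> fixed_modulo U"
      using u N.subgroup_subset_normalizer[OF U(1)] by (auto simp: fixed_modulo_def)
  qed
  show "subgroup (fixed_modulo U) N"
  proof (rule N.subgroupI)
    show "fixed_modulo U \<subseteq> carrier N" using M.subset by (auto simp: fixed_modulo_def)
    show "fixed_modulo U \<noteq> {}" using sub U.one_closed by blast
    fix x assume "x \<in> fixed_modulo U"
    then have x: "x \<in> normalizer N U" "\<And>a. a \<in> carrier A \<Longrightarrow> \<phi> a x \<otimes> inv x \<in> U"
      by (auto simp: fixed_modulo_def)
    have xc: "x \<in> carrier N" using x(1) by (rule M.mem_carrier)
    have "\<phi> a (inv x) \<otimes> inv (inv x) \<in> U" if a: "a \<in> carrier A" for a
    proof -
      have "inv x \<otimes> (inv (\<phi> a x \<otimes> inv x)) \<otimes> inv (inv x) \<in> U"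
        by (intro conj M.m_inv_closed x U.m_inv_closed a)
      moreover have "inv x \<otimes> (inv (\<phi> a x \<otimes> inv x)) \<otimes> inv (inv x) = \<phi> a (inv x) \<otimes> inv (inv x)"
        using xc closed[OF a xc] a by (simp add: N.inv_mult_group N.m_assoc N.inv_mult_cancel act_inv)
      ultimately show ?thesis by simp
    qed
    then show "inv x \<in> fixed_modulo U" using M.m_inv_closed[OF x(1)] by (simp add: fixed_modulo_def)
    fix y assume "y \<in> fixed_modulo U"
    then have y: "y \<in> normalizer N U" "\<And>a. a \<in> carrier A \<Longrightarrow> \<phi> a y \<otimes> inv y \<in> U"
      by (auto simp: fixed_modulo_def)
    have yc: "y \<in> carrier N" using y(1) by (rule M.mem_carrier)
    have "\<phi> a (x \<otimes> y) \<otimes> inv (x \<otimes> y) \<in> U" if a: "a \<in> carrier A" for a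
    proof -
      have "(\<phi> a x \<otimes> inv x) \<otimes> (x \<otimes> (\<phi> a y \<otimes> inv y) \<otimes> inv x) \<in> U"
        by (intro U.m_closed conj x y a)
      moreover have "(\<phi> a x \<otimes> inv x) \<otimes> (x \<otimes> (\<phi> a y \<otimes> inv y) \<otimes> inv x)
          = \<phi> a (x \<otimes> y) \<otimes> inv (x \<otimes> y)"
        using xc yc closed[OF a xc] closed[OF a yc] a
        by (simp add: N.inv_mult_group N.m_assoc N.inv_mult_cancel mult)
      ultimately show ?thesis by simp
    qed
    then show "x \<otimes> y \<in> fixed_modulo U" using M.m_closed[OF x(1) y(1)] by (simp add: fixed_modulo_def)
  qed
  show "invariant (fixed_modulo U)"
    unfolding invariant_def
  proof (intro ballI)
    fix b x assume b: "b \<in> carrier A" and "x \<in> fixed_modulo U"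
    then have x: "x \<in> normalizer N U" "\<And>a. a \<in> carrier A \<Longrightarrow> \<phi> a x \<otimes> inv x \<in> U"
      by (auto simp: fixed_modulo_def)
    have xc: "x \<in> carrier N" using x(1) by (rule M.mem_carrier)
    have "\<phi> a (\<phi> b x) \<otimes> inv (\<phi> b x) \<in> U" if a: "a \<in> carrier A" for a
    proof -
      define c where "c = inv\<^bsub>A\<^esub> b \<otimes>\<^bsub>A\<^esub> a \<otimes>\<^bsub>A\<^esub> b"
      have c: "c \<in> carrier A" using a b by (simp add: c_def)
      have "b \<otimes>\<^bsub>A\<^esub> c \<otimes>\<^bsub>A\<^esub> inv\<^bsub>A\<^esub> b = a"
        using a b by (simp add: c_def A.m_assoc A.inv_mult_cancel)
      then have "\<phi> b (\<phi> c x \<otimes> inv x) = \<phi> a (\<phi> b x) \<otimes> inv (\<phi> b x)"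
        using act_displacement[OF c b xc] by simp
      then show ?thesis using x(2)[OF c] U(2) b unfolding invariant_def by metis
    qed
    then show "\<phi> b x \<in> fixed_modulo U"
      using normalizer_invariant[OF Uc U(2)] b x(1) unfolding fixed_modulo_def invariant_def by blast
  qed
qed

text \<open>
  This is the mechanism behind both implications between left nilpotency and nilpotency. If the
  \<open>q\<close>-part of \<open>A\<close> acts trivially on the \<open>p\<close>-part of \<open>N\<close> for \<open>p \<noteq> q\<close>, then \<open>A\<close> acts on each
  \<open>p\<close>-part like a \<open>p\<close>-group, and fixed points exist modulo every proper invariant subgroup. The
  ascending series starting at the trivial subgroup therefore grows until it exhausts \<open>N\<close>, and the
  displacement series descends along it.

  The hypothesis \<open>grow\<close> supplies an element of prime power order that normalizes \<open>U\<close> without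
  lying in it. If \<open>N\<close> is nilpotent it follows from the growth of normalizers; if \<open>A = N\<close> acts by
  conjugation then invariant subgroups are normal.
\<close>

theorem displacement_series_reaches_one:
  assumes finN: "finite (carrier N)" and finA: "finite (carrier A)"
    and P: "\<And>p. prime p \<Longrightarrow> subgroup (P p) N \<and> invariant (P p) \<and> (\<exists>k. card (P p) = p ^ k)"
    and S: "\<And>q. prime q \<Longrightarrow> subgroup (S q) A \<and> card (S q) = q ^ multiplicity q (order A)"
    and triv: "\<And>p q a x. \<lbrakk>prime p; prime q; p \<noteq> q; a \<in> S q; x \<in> P p\<rbrakk> \<Longrightarrow> \<phi> a x = x"
    and grow: "\<And>U. \<lbrakk>subgroup U N; invariant U; U \<noteq> carrier N\<rbrakk> \<Longrightarrow>
      \<exists>p. prime p \<and> \<not> P p \<inter> normalizer N U \<subseteq> U"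
  shows "\<exists>n. displacement_series N A \<phi> n = {\<one>}"
proof -
  have step: "U \<subset> fixed_modulo U" if U: "subgroup U N" "invariant U" "U \<noteq> carrier N" for U
  proof -
    have Uc: "U \<subseteq> carrier N" by (rule subgroup.subset[OF U(1)])
    have NU: "subgroup (normalizer N U) N" by (rule N.normalizer_imp_subgroup[OF Uc])
    obtain p where p: "prime p" "\<not> P p \<inter> normalizer N U \<subseteq> U" using grow[OF U] by blast
    obtain k where Pp: "subgroup (P p) N" "invariant (P p)" "card (P p) = p ^ k"
      using P[OF p(1)] by blast
    define W where "W = P p \<inter> normalizer N U"
    have W: "subgroup W N" unfolding W_def by (rule N.subgroups_Inter_pair[OF Pp(1) NU])
    have finW: "finite W" using finN subgroup.subset[OF W] finite_subset by blast
    have "card W dvd p ^ k"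
      using N.card_subgroup_dvd[OF W Pp(1)] Pp(3) by (simp add: W_def)
    then obtain j where j: "card W = p ^ j" using p(1) by (auto simp: divides_primepow_nat)
    have invW: "invariant W"
      using Pp(2) normalizer_invariant[OF Uc U(2)] unfolding W_def invariant_def by blast
    have V: "subgroup (W \<inter> U) N" by (rule N.subgroups_Inter_pair[OF W U(1)])
    have VW: "W \<inter> U \<subset> W" using p(2) unfolding W_def by blast
    have invV: "invariant (W \<inter> U)" using invW U(2) unfolding invariant_def by blast
    have "\<exists>w \<in> W - (W \<inter> U). \<forall>a \<in> carrier A. \<phi> a w \<otimes> inv w \<in> W \<inter> U"
    proof (rule exists_fixed_modulo[OF finA p(1) W j finW invW V VW invV])
      fix q :: nat assume q: "prime q" "q \<noteq> p"
      have "\<forall>a \<in> S q. \<forall>w \<in> W. \<phi> a w = w"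
        using triv[OF p(1) q(1)] q(2) unfolding W_def by blast
      then show "\<exists>S. subgroup S A \<and> card S = q ^ multiplicity q (order A) \<and>
          (\<forall>a \<in> S. \<forall>w \<in> W. \<phi> a w = w)" using S[OF q(1)] by blast
    qed
    then obtain w where "w \<in> W" "w \<notin> U" "\<forall>a \<in> carrier A. \<phi> a w \<otimes> inv w \<in> U" by blast
    then have "w \<in> fixed_modulo U" "w \<notin> U" by (auto simp: W_def fixed_modulo_def)
    then show ?thesis using fixed_modulo_subgroup(3)[OF U(1,2)] by blast
  qed
  define U where "U i = (fixed_modulo ^^ i) {\<one>}" for i
  have U: "subgroup (U i) N \<and> invariant (U i)" for i
  proof (induction i)
    case 0
    then show ?case by (auto simp: U_def invariant_def act_of_one N.triv_subgroup)
  next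
    case (Suc i)
    then show ?case using fixed_modulo_subgroup by (simp add: U_def)
  qed
  have "\<exists>k. U k = carrier N"
  proof (rule ccontr)
    assume no: "\<not> ?thesis"
    have "i \<le> card (U i)" for i
    proof (induction i)
      case (Suc i)
      have "U i \<subset> U (Suc i)" using step no U by (simp add: U_def)
      moreover have "finite (U (Suc i))"
        using finN U[of "Suc i"] subgroup.subset finite_subset by blast
      ultimately have "card (U i) < card (U (Suc i))" by (intro psubset_card_mono)
      then show ?case using Suc by simp
    qed simp
    from this[of "Suc (order N)"] show False
      using card_mono[OF finN subgroup.subset[OF conjunct1[OF U[of "Suc (order N)"]]]]
      by (simp add: order_def)
  qed
  then obtain k where k: "U k = carrier N" by blast
  have "j \<le> k \<Longrightarrow> displacement_series N A \<phi> j \<subseteq> U (k - j)" for j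
  proof (induction j)
    case (Suc j)
    have "U (k - j) = fixed_modulo (U (k - Suc j))"
    proof -
      have "k - j = Suc (k - Suc j)" using Suc(2) by simp
      then show ?thesis unfolding U_def by (simp only: funpow.simps o_apply)
    qed
    then have "displacement_series N A \<phi> j \<subseteq> fixed_modulo (U (k - Suc j))" using Suc by simp
    then show ?case
      unfolding displacement_series.simps using U
      by (intro N.generate_subgroup_incl) (auto simp: fixed_modulo_def)
  qed (simp add: k)
  from this[of k] have "displacement_series N A \<phi> k \<subseteq> {\<one>}" by (simp add: U_def)
  moreover have "\<one> \<in> displacement_series N A \<phi> k"
    using displacement_series_subgroup subgroup.one_closed by blast
  ultimately show ?thesis by blast
qed

text \<open>
  With \<open>c\<close> the displacement of \<open>x\<close>, fixed by \<open>a\<close>, iterating gives that the \<open>n\<close>-th power of \<open>a\<close>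
  sends \<open>x\<close> to \<open>c\<^sup>n x\<close>.
\<close>

lemma coprime_displacement_trivial:
  fixes m :: nat
  assumes a: "a \<in> carrier A" "a [^]\<^bsub>A\<^esub> m = \<one>\<^bsub>A\<^esub>" and x: "x \<in> carrier N"
    and fixed: "\<phi> a (\<phi> a x \<otimes> inv x) = \<phi> a x \<otimes> inv x"
  shows "(\<phi> a x \<otimes> inv x) [^] m = \<one>"
proof -
  define c where "c = \<phi> a x \<otimes> inv x"
  have c: "c \<in> carrier N" "\<phi> a c = c" using a x fixed by (simp_all add: c_def closed)
  have ax: "\<phi> a x = c \<otimes> x" using closed[OF a(1) x] x by (simp add: c_def N.m_assoc)
  have "\<phi> (a [^]\<^bsub>A\<^esub> n) x = c [^] n \<otimes> x" for n :: nat
  proof (induction n)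
    case 0
    then show ?case using x by (simp add: act_one)
  next
    case (Suc n)
    have "\<phi> (a [^]\<^bsub>A\<^esub> Suc n) x = \<phi> (a [^]\<^bsub>A\<^esub> n) (c \<otimes> x)"
      using a(1) x by (simp add: comp ax)
    also have "\<dots> = \<phi> (a [^]\<^bsub>A\<^esub> n) c \<otimes> (c [^] n \<otimes> x)"
      using a(1) x c Suc by (simp add: mult)
    also have "\<phi> (a [^]\<^bsub>A\<^esub> n) c = c"
      using a(1) c by (induction n) (simp_all add: act_one comp)
    also have "c \<otimes> (c [^] n \<otimes> x) = c [^] Suc n \<otimes> x"
      using c x by (simp only: N.nat_pow_Suc2) (simp add: N.m_assoc)
    finally show ?case .
  qed
  from this[of m] have "x = c [^] m \<otimes> x" using a(2) x by (simp add: act_one)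
  then show ?thesis using c(1) x unfolding c_def[symmetric] by simp
qed

text \<open>
  Coprime automorphisms that stabilize a series are trivial. Iterated displacements of \<open>x\<close> by \<open>a\<close>
  are \<open>p\<close>-elements that descend along the displacement series and finally vanish. Going back up,
  if \<open>a\<close> fixes a displacement \<open>c\<close>, then the order of \<open>c\<close> divides a power of \<open>q\<close>, so
  \<open>c = 1\<close> and \<open>a\<close> fixes the element whose displacement \<open>c\<close> is.
\<close>

lemma coprime_action_trivial:
  assumes nil: "displacement_series N A \<phi> n = {\<one>}"
    and p: "prime p" and q: "prime q" and "p \<noteq> q"
    and P: "subgroup (primary_elements N p) N"
    and a: "a \<in> primary_elements A q" and x: "x \<in> primary_elements N p"
  shows "\<phi> a x = x"
proof -
  obtain k where ac: "a \<in> carrier A" and ak: "a [^]\<^bsub>A\<^esub> (q ^ k) = \<one>\<^bsub>A\<^esub>"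
    using a by (auto simp: primary_elements_def)
  have Pc: "primary_elements N p \<subseteq> carrier N" by (auto simp: primary_elements_def)
  have displ: "\<phi> a y \<otimes> inv y \<in> primary_elements N p" if "y \<in> primary_elements N p" for y
    using primary_elements_invariant[of p] that ac subgroup.m_closed[OF P] subgroup.m_inv_closed[OF P]
    unfolding invariant_def by blast
  have "y \<in> displacement_series N A \<phi> i \<Longrightarrow> y \<in> primary_elements N p \<Longrightarrow> i \<le> n \<Longrightarrow> \<phi> a y = y" for i y
  proof (induction "n - i" arbitrary: i y)
    case 0
    then have "y = \<one>" using nil by simp
    then show ?case using act_of_one ac by simp
  next
    case (Suc d)
    define c where "c = \<phi> a y \<otimes> inv y"
    have yc: "y \<in> carrier N" using Suc.prems Pc by blast
    have c: "c \<in> displacement_series N A \<phi> (Suc i)" "c \<in> primary_elements N p"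
      unfolding c_def using displacement_mem_series[OF ac Suc.prems(1)] displ[OF Suc.prems(2)] by auto
    have "\<phi> a c = c" using Suc.hyps Suc.prems c by (intro Suc.hyps(1)[of "Suc i"]) auto
    then have "c [^] (q ^ k) = \<one>"
      unfolding c_def by (rule coprime_displacement_trivial[OF ac ak yc])
    then have "c \<in> primary_elements N q" using c(2) Pc by (auto intro!: primary_elementsI)
    then have "c = \<one>" using N.primary_elements_Int[OF p q \<open>p \<noteq> q\<close> c(2)] by blast
    then show ?case
      using closed[OF ac yc] yc N.inv_solve_right'[of \<one> "\<phi> a y" y] by (simp add: c_def)
  qed
  from this[of x 0] show ?thesis using x Pc by auto
qed

end

section \<open>Left nilpotency and multiplicative nilpotency\<close>

lemma (in group) conjugation_automorphism_action:
  "automorphism_action G G (\<lambda>g x. g \<otimes> x \<otimes> inv g)"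
proof unfold_locales
qed (simp_all add: m_assoc inv_mult_cancel inv_mult_group)

lemma lower_central_eq_displacement_series:
  "lower_central G n = displacement_series G G (\<lambda>g x. g \<otimes>\<^bsub>G\<^esub> x \<otimes>\<^bsub>G\<^esub> inv\<^bsub>G\<^esub> g) n"
  by (induction n) simp_all

text \<open>
  A skew brace seen as a pair of groups on one carrier. Keeping the two groups as separate records
  allows the results on group actions to be used for either of them without unfolding the ring
  notation for the additive group.
\<close>

locale brace_groups = N: group N + A: group A
  for N :: "('a, 'm) monoid_scheme" (structure) and A :: "('a, 'n) monoid_scheme" +
  assumes carrier_eq: "carrier A = carrier N"
    and brace: "\<lbrakk>a \<in> carrier N; b \<in> carrier N; c \<in> carrier N\<rbrakk> \<Longrightarrow>
      a \<otimes>\<^bsub>A\<^esub> (b \<otimes> c) = (a \<otimes>\<^bsub>A\<^esub> b) \<otimes> inv a \<otimes> (a \<otimes>\<^bsub>A\<^esub> c)"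
begin

definition lam :: "'a \<Rightarrow> 'a \<Rightarrow> 'a" where
  "lam a b = inv a \<otimes> (a \<otimes>\<^bsub>A\<^esub> b)"

lemma A_closed [simp]: "\<lbrakk>a \<in> carrier N; b \<in> carrier N\<rbrakk> \<Longrightarrow> a \<otimes>\<^bsub>A\<^esub> b \<in> carrier N"
  using A.m_closed by (simp add: carrier_eq)

lemma A_inv_closed [simp]: "a \<in> carrier N \<Longrightarrow> inv\<^bsub>A\<^esub> a \<in> carrier N"
  using A.inv_closed by (simp add: carrier_eq)

lemma lam_closed [simp]: "\<lbrakk>a \<in> carrier N; b \<in> carrier N\<rbrakk> \<Longrightarrow> lam a b \<in> carrier N"
  by (simp add: lam_def)

lemma A_mult_eq: "\<lbrakk>a \<in> carrier N; b \<in> carrier N\<rbrakk> \<Longrightarrow> a \<otimes>\<^bsub>A\<^esub> b = a \<otimes> lam a b"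
  by (simp add: lam_def N.inv_mult_cancel)

lemma lam_mult:
  "\<lbrakk>a \<in> carrier N; b \<in> carrier N; c \<in> carrier N\<rbrakk> \<Longrightarrow> lam a (b \<otimes> c) = lam a b \<otimes> lam a c"
  by (simp add: lam_def brace N.m_assoc)

lemma lam_one: "a \<in> carrier N \<Longrightarrow> lam a \<one> = \<one>"
  using lam_mult[of a \<one> \<one>] N.l_cancel_one'[of "lam a \<one>" "lam a \<one>"] by simp

text \<open>
  The map \<open>\<lambda>\<^sub>1\<close> fixes the additive identity \<open>0\<close>, so \<open>0 = 1 \<cdot> 0 = 1 + 0 = 1\<close>.
\<close>

lemma one_eq: "\<one>\<^bsub>A\<^esub> = \<one>"
  using A_mult_eq[of "\<one>\<^bsub>A\<^esub>" \<one>] A.one_closed by (simp add: carrier_eq lam_one)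

lemma lam_comp:
  assumes a: "a \<in> carrier N" and b: "b \<in> carrier N" and c: "c \<in> carrier N"
  shows "lam (a \<otimes>\<^bsub>A\<^esub> b) c = lam a (lam b c)"
proof -
  have "a \<otimes>\<^bsub>A\<^esub> b \<otimes>\<^bsub>A\<^esub> c = a \<otimes>\<^bsub>A\<^esub> (b \<otimes>\<^bsub>A\<^esub> c)" using assms by (simp add: A.m_assoc carrier_eq)
  also have "\<dots> = a \<otimes> lam a (b \<otimes> lam b c)" using assms A_mult_eq by simp
  also have "\<dots> = (a \<otimes> lam a b) \<otimes> lam a (lam b c)" using assms by (simp add: lam_mult N.m_assoc)
  also have "a \<otimes> lam a b = a \<otimes>\<^bsub>A\<^esub> b" using assms A_mult_eq by simp
  finally have "a \<otimes>\<^bsub>A\<^esub> b \<otimes>\<^bsub>A\<^esub> c = (a \<otimes>\<^bsub>A\<^esub> b) \<otimes> lam a (lam b c)" .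
  then show ?thesis unfolding lam_def[of "a \<otimes>\<^bsub>A\<^esub> b"] using assms by (simp add: N.inv_mult_cancel)
qed

lemma lam_action: "automorphism_action N A lam"
proof unfold_locales
  show "lam \<one>\<^bsub>A\<^esub> x = x" if "x \<in> carrier N" for x
    using that A.l_one[of x] by (simp add: lam_def one_eq carrier_eq)
qed (simp_all add: carrier_eq lam_mult lam_comp)

end

sublocale brace_groups \<subseteq> lam: automorphism_action N A lam
  by (rule lam_action)

locale nilpotent_type_brace_groups = brace_groups +
  assumes fin: "finite (carrier N)" and nil_type: "nilpotent_group N"
begin

abbreviation P :: "nat \<Rightarrow> 'a set" where "P p \<equiv> primary_elements N p"

lemma finA: "finite (carrier A)" and order_eq: "order A = order N"
  using fin by (simp_all add: carrier_eq order_def)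

lemma P_subset: "P p \<subseteq> carrier N" by (auto simp: primary_elements_def)

text \<open>
  Each Sylow subgroup of the additive group is characteristic, hence invariant under \<open>\<lambda>\<close>, hence closed
  under multiplication. So the same set is a Sylow subgroup of both groups, and this is what links
  the arithmetic of the two.
\<close>

lemma P_sylow:
  assumes p: "prime p"
  shows "subgroup (P p) N" and "card (P p) = p ^ multiplicity p (order N)" and "subgroup (P p) A"
proof -
  show s: "subgroup (P p) N" and "card (P p) = p ^ multiplicity p (order N)"
    by (rule N.nilpotent_primary_sylow[OF nil_type fin p])+
  interpret P: subgroup "P p" N by (rule s)
  have lamP: "lam a x \<in> P p" if "a \<in> carrier N" "x \<in> P p" for a x
    using lam.primary_elements_invariant[of p] that by (simp add: lam.invariant_def carrier_eq)
  show "subgroup (P p) A"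
  proof (rule A.subgroupI)
    show "P p \<subseteq> carrier A" using P_subset carrier_eq by simp
    show "P p \<noteq> {}" using P.one_closed by blast
    fix a assume a: "a \<in> P p"
    have ac: "a \<in> carrier N" using a by (rule P.mem_carrier)
    \<comment> \<open>The multiplicative inverse of \<open>a\<close> is the additive inverse of a \<open>\<lambda>\<close>-translate of \<open>a\<close>,
      and \<open>P p\<close> is closed under both operations.\<close>
    have "inv\<^bsub>A\<^esub> a \<otimes> lam (inv\<^bsub>A\<^esub> a) a = \<one>"
      using A_mult_eq[of "inv\<^bsub>A\<^esub> a" a] ac A.l_inv[of a] by (simp add: carrier_eq one_eq)
    then have "inv\<^bsub>A\<^esub> a = inv (lam (inv\<^bsub>A\<^esub> a) a)"
      using ac N.inv_equality by (intro N.inv_equality[symmetric]) auto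
    then show "inv\<^bsub>A\<^esub> a \<in> P p" using P.m_inv_closed[OF lamP[OF A_inv_closed[OF ac] a]] by simp
    fix b assume b: "b \<in> P p"
    then show "a \<otimes>\<^bsub>A\<^esub> b \<in> P p"
      using A_mult_eq[OF ac P.mem_carrier[OF b]] P.m_closed[OF a lamP[OF ac b]] by simp
  qed
qed

lemma P_subset_primary_A: "prime p \<Longrightarrow> P p \<subseteq> primary_elements A p"
  using A.prime_power_subgroup_subset_primary[OF P_sylow(3,2)] finite_subset[OF P_subset fin] by blast

lemma subgroup_containing_P:
  assumes U: "subgroup U A" and P: "\<And>p. prime p \<Longrightarrow> P p \<subseteq> U"
  shows "U = carrier A"
proof -
  have o: "order A \<noteq> 0" using A.order_gt_0_iff_finite finA by simp
  have "order A dvd card U"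
  proof (rule dvd_if_prime_parts_dvd[OF o])
    fix p :: nat assume p: "prime p"
    then show "p ^ multiplicity p (order A) dvd card U"
      using A.card_subgroup_dvd[OF P_sylow(3) U P] P_sylow(2) by (simp add: order_eq)
  qed
  moreover have "card U > 0"
    using finite_subset[OF subgroup.subset[OF U] finA] subgroup.one_closed[OF U]
    by (auto simp: card_gt_0_iff)
  ultimately have "card (carrier A) \<le> card U" by (simp add: order_def dvd_imp_le)
  then show ?thesis using card_seteq[OF finA subgroup.subset[OF U]] by simp
qed

text \<open>
  For \<open>a\<close> in the \<open>q\<close>-part and \<open>x\<close> in the \<open>p\<close>-part, the elements commute in both groups, so that
  \<open>a + \<lambda>\<^sub>a(x) = a x = x a = x + \<lambda>\<^sub>x(a)\<close>. Then \<open>-x + \<lambda>\<^sub>a(x) = \<lambda>\<^sub>x(a) - a\<close> is both a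
  \<open>p\<close>-element and a \<open>q\<close>-element, and \<open>a\<close> acts trivially on \<open>x\<close>.
\<close>

theorem left_nilpotent_if_nilpotent:
  assumes nilA: "nilpotent_group A"
  shows "\<exists>n. displacement_series N A lam n = {\<one>}"
proof (rule lam.displacement_series_reaches_one[OF fin finA, where P = P and S = P])
  show "subgroup (P p) N \<and> lam.invariant (P p) \<and> (\<exists>k. card (P p) = p ^ k)" if "prime p" for p
    using P_sylow[OF that] lam.primary_elements_invariant by blast
  show "subgroup (P q) A \<and> card (P q) = q ^ multiplicity q (order A)" if "prime q" for q
    using P_sylow[OF that] by (simp add: order_eq)
next
  fix p q a x assume p: "prime p" and q: "prime q" and "p \<noteq> q" and a: "a \<in> P q" and x: "x \<in> P p"
  interpret Pp: subgroup "P p" N by (rule P_sylow[OF p])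
  interpret Pq: subgroup "P q" N by (rule P_sylow[OF q])
  have ac: "a \<in> carrier N" and xc: "x \<in> carrier N" using a x by auto
  have lx: "lam a x \<in> P p" and la: "lam x a \<in> P q"
    using lam.primary_elements_invariant a x ac xc by (auto simp: lam.invariant_def carrier_eq)
  have "lam a x \<otimes> a = a \<otimes> lam a x"
    by (rule N.nilpotent_primary_commute[OF nil_type fin p q \<open>p \<noteq> q\<close> lx a])
  also have "\<dots> = a \<otimes>\<^bsub>A\<^esub> x" using A_mult_eq[OF ac xc] by simp
  also have "\<dots> = x \<otimes>\<^bsub>A\<^esub> a"
    using A.nilpotent_primary_commute[OF nilA finA q p _ subsetD[OF P_subset_primary_A[OF q] a]
        subsetD[OF P_subset_primary_A[OF p] x]] \<open>p \<noteq> q\<close> by simp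
  also have "\<dots> = x \<otimes> lam x a" using A_mult_eq[OF xc ac] .
  finally have eq: "lam a x \<otimes> a = x \<otimes> lam x a" .
  have "inv x \<otimes> lam a x = inv x \<otimes> (lam a x \<otimes> a) \<otimes> inv a"
    using ac xc by (simp add: N.m_assoc)
  also have "\<dots> = lam x a \<otimes> inv a"
    unfolding eq using ac xc by (simp add: N.inv_mult_cancel)
  finally have "inv x \<otimes> lam a x = lam x a \<otimes> inv a" .
  moreover have "inv x \<otimes> lam a x \<in> P p" by (intro Pp.m_closed Pp.m_inv_closed x lx)
  moreover have "lam x a \<otimes> inv a \<in> P q" by (intro Pq.m_closed Pq.m_inv_closed a la)
  ultimately have "inv x \<otimes> lam a x = \<one>"
    using N.primary_elements_Int[OF p q \<open>p \<noteq> q\<close>] by simp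
  then have "x \<otimes> (inv x \<otimes> lam a x) = x" using xc by simp
  then show "lam a x = x" using ac xc by (simp add: N.inv_mult_cancel)
next
  fix U assume U: "subgroup U N" "U \<noteq> carrier N"
  have "U \<subset> normalizer N U" by (rule N.nilpotent_normalizer_grows[OF nil_type U])
  then obtain p x where "prime p" "x \<in> P p" "x \<in> normalizer N U" "x \<notin> U"
    using N.exists_primary_outside[OF fin N.normalizer_imp_subgroup[OF subgroup.subset[OF U(1)]] U(1)]
    by metis
  then show "\<exists>p. prime p \<and> \<not> P p \<inter> normalizer N U \<subseteq> U" by blast
qed

text \<open>
  Left nilpotency means that \<open>\<lambda>\<close> stabilizes a series, so the coprime parts act trivially on each
  other. Multiplication and addition therefore agree on elements of coprime order, and these commute
  in the multiplicative group because they commute in the additive one. It remains to apply the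
  termination criterion to the conjugation action.
\<close>

theorem nilpotent_if_left_nilpotent:
  assumes left: "displacement_series N A lam n = {\<one>}"
  shows "nilpotent_group A"
proof -
  have comm: "a \<otimes>\<^bsub>A\<^esub> x = x \<otimes>\<^bsub>A\<^esub> a"
    if pq: "prime p" "prime q" "p \<noteq> q" and a: "a \<in> P q" and x: "x \<in> P p" for p q a x
  proof -
    have c: "a \<in> carrier N" "x \<in> carrier N" using a x P_subset by auto
    have "lam a x = x"
      using lam.coprime_action_trivial[OF left pq P_sylow(1)[OF pq(1)] _ x] P_subset_primary_A[OF pq(2)] a by blast
    moreover have "lam x a = a"
      using lam.coprime_action_trivial[OF left pq(2,1) _ P_sylow(1)[OF pq(2)] _ a] pq(3)
        P_subset_primary_A[OF pq(1)] x by blast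
    moreover have "a \<otimes> x = x \<otimes> a"
      using N.nilpotent_primary_commute[OF nil_type fin pq x a] by simp
    ultimately show ?thesis using A_mult_eq c by simp
  qed
  interpret conj: automorphism_action A A "\<lambda>g x. g \<otimes>\<^bsub>A\<^esub> x \<otimes>\<^bsub>A\<^esub> inv\<^bsub>A\<^esub> g"
    by (rule A.conjugation_automorphism_action)
  \<comment> \<open>The normalizer contains a Sylow subgroup for every prime.\<close>
  have norm: "normalizer A (P p) = carrier A" if p: "prime p" for p
  proof (rule subgroup_containing_P)
    have Pc: "P p \<subseteq> carrier A" using P_subset carrier_eq by simp
    show "subgroup (normalizer A (P p)) A" by (rule A.normalizer_imp_subgroup[OF Pc])
    fix q :: nat assume q: "prime q"
    show "P q \<subseteq> normalizer A (P p)"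
    proof (cases "q = p")
      case True
      then show ?thesis using A.subgroup_subset_normalizer[OF P_sylow(3)[OF p]] by simp
    next
      case False
      show ?thesis
      proof
        fix a assume a: "a \<in> P q"
        have ac: "a \<in> carrier A" using a P_subset carrier_eq by blast
        have fixed: "a \<otimes>\<^bsub>A\<^esub> x \<otimes>\<^bsub>A\<^esub> inv\<^bsub>A\<^esub> a = x" if x: "x \<in> P p" for x
          using comm[OF p q _ a x] False ac subsetD[OF Pc x] by (simp add: A.m_assoc)
        have mem: "u \<in> P p" if "u \<in> carrier A" "a \<otimes>\<^bsub>A\<^esub> u \<otimes>\<^bsub>A\<^esub> inv\<^bsub>A\<^esub> a \<in> P p" for u
        proof -
          have "a \<otimes>\<^bsub>A\<^esub> (a \<otimes>\<^bsub>A\<^esub> u \<otimes>\<^bsub>A\<^esub> inv\<^bsub>A\<^esub> a) \<otimes>\<^bsub>A\<^esub> inv\<^bsub>A\<^esub> a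
              = a \<otimes>\<^bsub>A\<^esub> u \<otimes>\<^bsub>A\<^esub> inv\<^bsub>A\<^esub> a" by (rule fixed[OF that(2)])
          then have "a \<otimes>\<^bsub>A\<^esub> u \<otimes>\<^bsub>A\<^esub> inv\<^bsub>A\<^esub> a = u" using ac that(1) by simp
          then show ?thesis using that(2) by simp
        qed
        show "a \<in> normalizer A (P p)"
          unfolding A.normalizer_iff[OF Pc]
        proof (intro conjI ballI iffI ac)
          fix u assume "u \<in> P p"
          then show "a \<otimes>\<^bsub>A\<^esub> u \<otimes>\<^bsub>A\<^esub> inv\<^bsub>A\<^esub> a \<in> P p" by (simp only: fixed)
        qed (rule mem)
      qed
    qed
  qed
  have "\<exists>n. displacement_series A A (\<lambda>g x. g \<otimes>\<^bsub>A\<^esub> x \<otimes>\<^bsub>A\<^esub> inv\<^bsub>A\<^esub> g) n = {\<one>\<^bsub>A\<^esub>}"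
  proof (rule conj.displacement_series_reaches_one[OF finA finA, where P = P and S = P])
    fix p :: nat assume p: "prime p"
    have Pc: "P p \<subseteq> carrier A" using P_subset carrier_eq by simp
    have "conj.invariant (P p)"
      unfolding conj.invariant_def using norm[OF p] A.normalizer_iff[OF Pc] Pc by blast
    then show "subgroup (P p) A \<and> conj.invariant (P p) \<and> (\<exists>k. card (P p) = p ^ k)"
      using P_sylow[OF p] by blast
    show "subgroup (P p) A \<and> card (P p) = p ^ multiplicity p (order A)"
      using P_sylow[OF p] by (simp add: order_eq)
  next
    fix p q a x assume "prime p" "prime q" "p \<noteq> q" and a: "a \<in> P q" and x: "x \<in> P p"
    then have "a \<otimes>\<^bsub>A\<^esub> x = x \<otimes>\<^bsub>A\<^esub> a" by (rule comm)
    then show "a \<otimes>\<^bsub>A\<^esub> x \<otimes>\<^bsub>A\<^esub> inv\<^bsub>A\<^esub> a = x"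
      using subsetD[OF P_subset a] subsetD[OF P_subset x] by (simp add: A.m_assoc carrier_eq)
  next
    fix U assume U: "subgroup U A" "conj.invariant U" "U \<noteq> carrier A"
    have Uc: "U \<subseteq> carrier A" by (rule subgroup.subset[OF U(1)])
    obtain p where p: "prime p" "\<not> P p \<subseteq> U" using subgroup_containing_P[OF U(1)] U(3) by blast
    have "a \<in> normalizer A U" if a: "a \<in> carrier A" for a
      unfolding A.normalizer_iff[OF Uc]
    proof (intro conjI ballI iffI a)
      fix u assume u: "u \<in> carrier A" and "a \<otimes>\<^bsub>A\<^esub> u \<otimes>\<^bsub>A\<^esub> inv\<^bsub>A\<^esub> a \<in> U"
      then have "inv\<^bsub>A\<^esub> a \<otimes>\<^bsub>A\<^esub> (a \<otimes>\<^bsub>A\<^esub> u \<otimes>\<^bsub>A\<^esub> inv\<^bsub>A\<^esub> a) \<otimes>\<^bsub>A\<^esub> inv\<^bsub>A\<^esub> (inv\<^bsub>A\<^esub> a) \<in> U"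
        using U(2) A.inv_closed[OF a] unfolding conj.invariant_def by blast
      then show "u \<in> U" using a u by (simp add: A.m_assoc A.inv_mult_cancel)
    next
      fix u assume "u \<in> U"
      then show "a \<otimes>\<^bsub>A\<^esub> u \<otimes>\<^bsub>A\<^esub> inv\<^bsub>A\<^esub> a \<in> U" using U(2) a unfolding conj.invariant_def by blast
    qed
    then have "P p \<inter> normalizer A U = P p" using P_subset carrier_eq by blast
    then show "\<exists>p. prime p \<and> \<not> P p \<inter> normalizer A U \<subseteq> U" using p by metis
  qed
  then show ?thesis
    unfolding nilpotent_group_def lower_central_eq_displacement_series using A.is_group by blast
qed

end

section \<open>Series of quotients\<close>

lemma displacement_series_image:
  assumes hom: "group_hom N N' h" and surj: "h ` carrier N = carrier N'"
    and A: "k ` carrier A = carrier A'" and act: "automorphism_action N A \<phi>"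
    and equiv: "\<And>a x. a \<in> carrier A \<Longrightarrow> x \<in> carrier N \<Longrightarrow> h (\<phi> a x) = \<psi> (k a) (h x)"
  shows "displacement_series N' A' \<psi> n = h ` displacement_series N A \<phi> n"
proof (induction n)
  case 0
  then show ?case by (simp add: surj)
next
  case (Suc n)
  interpret h: group_hom N N' h by (rule hom)
  interpret act: automorphism_action N A \<phi> by (rule act)
  let ?D = "displacement_series N A \<phi> n"
  let ?S = "\<Union>a \<in> carrier A. \<Union>x \<in> ?D. {\<phi> a x \<otimes>\<^bsub>N\<^esub> inv\<^bsub>N\<^esub> x}"
  have D: "x \<in> carrier N" if "x \<in> ?D" for x using that act.displacement_series_subset by blast
  have S: "?S \<subseteq> carrier N" using D act.closed by auto
  have step: "h (\<phi> a x \<otimes>\<^bsub>N\<^esub> inv\<^bsub>N\<^esub> x) = \<psi> (k a) (h x) \<otimes>\<^bsub>N'\<^esub> inv\<^bsub>N'\<^esub> (h x)"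
    if "a \<in> carrier A" "x \<in> ?D" for a x
    using that D act.closed by (simp add: equiv)
  have "h ` ?S = (\<Union>a \<in> carrier A. \<Union>x \<in> ?D. {h (\<phi> a x \<otimes>\<^bsub>N\<^esub> inv\<^bsub>N\<^esub> x)})"
    by blast
  also have "\<dots> = (\<Union>a \<in> carrier A. \<Union>x \<in> ?D. {\<psi> (k a) (h x) \<otimes>\<^bsub>N'\<^esub> inv\<^bsub>N'\<^esub> (h x)})"
    using step by (intro SUP_cong refl) auto
  also have "\<dots> = (\<Union>a \<in> carrier A'. \<Union>x \<in> h ` ?D. {\<psi> a x \<otimes>\<^bsub>N'\<^esub> inv\<^bsub>N'\<^esub> x})"
    by (simp flip: A)
  finally show ?case
    unfolding displacement_series.simps Suc using h.generate_img[OF S] by simp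
qed

lemma lower_central_image:
  assumes hom: "group_hom G H h" and surj: "h ` carrier G = carrier H"
  shows "lower_central H n = h ` lower_central G n"
proof -
  interpret h: group_hom G H h by (rule hom)
  show ?thesis
    unfolding lower_central_eq_displacement_series
    by (rule displacement_series_image[OF hom surj surj h.G.conjugation_automorphism_action]) simp
qed

lemma (in group) lower_central_subgroup: "subgroup (lower_central G n) G"
  and lower_central_antimono: "m \<le> n \<Longrightarrow> lower_central G n \<subseteq> lower_central G m"
  and lower_central_normal: "lower_central G n \<lhd> G"
proof -
  interpret conj: automorphism_action G G "\<lambda>g x. g \<otimes> x \<otimes> inv g"
    by (rule conjugation_automorphism_action)
  show "m \<le> n \<Longrightarrow> lower_central G n \<subseteq> lower_central G m"
    unfolding lower_central_eq_displacement_series by (rule conj.displacement_series_antimono)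
  show s: "subgroup (lower_central G n) G"
    unfolding lower_central_eq_displacement_series using conj.displacement_series_subgroup by blast
  have "conj.invariant (lower_central G n)"
    unfolding lower_central_eq_displacement_series using conj.displacement_series_subgroup by blast
  then show "lower_central G n \<lhd> G"
    using s by (intro normal_invI) (auto simp: conj.invariant_def)
qed

lemma (in group) image_r_coset_trivial_iff:
  assumes "subgroup H G" "S \<subseteq> carrier G" "S \<noteq> {}"
  shows "(\<lambda>x. H #> x) ` S = {H} \<longleftrightarrow> S \<subseteq> H"
proof
  assume eq: "(\<lambda>x. H #> x) ` S = {H}"
  show "S \<subseteq> H"
  proof
    fix x assume x: "x \<in> S"
    then have "H #> x = H" using eq by blast
    moreover have "x \<in> H #> x" using x assms by (intro rcos_self) auto
    ultimately show "x \<in> H" by simp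
  qed
next
  assume "S \<subseteq> H"
  then have "H #> x = H" if "x \<in> S" for x
    using that assms(1,2) by (intro coset_join2) auto
  then show "(\<lambda>x. H #> x) ` S = {H}" using assms(3) by auto
qed

lemma (in group) nilpotent_Mod_iff:
  assumes "N \<lhd> G"
  shows "nilpotent_group (G Mod N) \<longleftrightarrow> (\<exists>n. lower_central G n \<subseteq> N)"
proof -
  interpret N: normal N G by (rule assms)
  interpret Q: group "G Mod N" by (rule N.factorgroup_is_group)
  have hom: "group_hom G (G Mod N) (\<lambda>x. N #> x)"
    by unfold_locales (rule N.r_coset_hom_Mod)
  have surj: "(\<lambda>x. N #> x) ` carrier G = carrier (G Mod N)"
    by (auto simp: FactGroup_def RCOSETS_def)
  have "lower_central (G Mod N) n = {\<one>\<^bsub>G Mod N\<^esub>} \<longleftrightarrow> lower_central G n \<subseteq> N" for n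
  proof -
    have "lower_central G n \<noteq> {}" using subgroup.one_closed[OF lower_central_subgroup] by blast
    then show ?thesis
      unfolding lower_central_image[OF hom surj]
      using image_r_coset_trivial_iff[OF N.subgroup_axioms subgroup.subset[OF lower_central_subgroup]]
      by (simp add: FactGroup_def)
  qed
  then show ?thesis unfolding nilpotent_group_def using Q.is_group by simp
qed

lemma finite_antimono_reaches_Inter:
  fixes D :: "nat \<Rightarrow> 'a set"
  assumes fin: "finite (D 0)" and anti: "\<And>m n. m \<le> n \<Longrightarrow> D n \<subseteq> D m"
  shows "\<exists>n. D n = (\<Inter>i. D i)"
proof -
  obtain n where n: "\<And>m. card (D n) \<le> card (D m)"
    using ex_has_least_nat[of "\<lambda>_. True" 0 "\<lambda>n. card (D n)"] by blast
  have finD: "finite (D m)" for m using fin anti[of 0 m] finite_subset by auto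
  have "D n \<subseteq> D i" for i
  proof -
    have "D (max n i) = D n"
      using card_seteq[OF finD anti[of n "max n i"] n] by simp
    then show ?thesis using anti[of i "max n i"] by simp
  qed
  then show ?thesis by blast
qed

lemma antimono_Inter_subset_iff:
  fixes D :: "nat \<Rightarrow> 'a set"
  assumes "finite (D 0)" "\<And>m n. m \<le> n \<Longrightarrow> D n \<subseteq> D m"
  shows "(\<Inter>i. D i) \<subseteq> I \<longleftrightarrow> (\<exists>n. D n \<subseteq> I)"
  using finite_antimono_reaches_Inter[of D] assms by (metis INT_lower UNIV_I order_trans)

text \<open>
  In a finite group the lower central series becomes stationary. Its last term is normal and lies
  in a normal subgroup precisely when the quotient by the latter is nilpotent; hence it is the
  smallest such subgroup.
\<close>

lemma (in group) nilpotent_Mod_iff_gamma_infinity: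
  assumes fin: "finite (carrier G)" and N: "N \<lhd> G"
  shows "nilpotent_group (G Mod N) \<longleftrightarrow> gamma_infinity G \<subseteq> N"
proof -
  let ?L = "\<Inter>n. lower_central G n"
  have iff: "nilpotent_group (G Mod M) \<longleftrightarrow> ?L \<subseteq> M" if "M \<lhd> G" for M
    unfolding nilpotent_Mod_iff[OF that]
    by (rule antimono_Inter_subset_iff[symmetric]) (simp_all add: fin lower_central_antimono)
  have "\<exists>n. lower_central G n = ?L"
    by (rule finite_antimono_reaches_Inter) (simp_all add: fin lower_central_antimono)
  then have L: "?L \<lhd> G" using lower_central_normal by metis
  have "gamma_infinity G = ?L"
    unfolding gamma_infinity_def by (rule Least_equality) (use L iff in auto)
  then show ?thesis using iff[OF N] by simp
qed

section \<open>Skew braces and their quotients\<close>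

context skew_brace
begin

lemma brace_groups: "brace_groups (add_monoid X) X"
proof -
  interpret N: group "add_monoid X" by (rule add_group)
  interpret A: group X by (rule mult_group)
  show ?thesis
  proof unfold_locales
    fix a b c assume "a \<in> carrier (add_monoid X)" "b \<in> carrier (add_monoid X)" "c \<in> carrier (add_monoid X)"
    then show "a \<otimes> (b \<otimes>\<^bsub>add_monoid X\<^esub> c) =
        (a \<otimes> b) \<otimes>\<^bsub>add_monoid X\<^esub> inv\<^bsub>add_monoid X\<^esub> a \<otimes>\<^bsub>add_monoid X\<^esub> (a \<otimes> c)"
      using brace by (simp add: a_minus_def a_inv_def)
  qed simp
qed

lemma lam_eq: "brace_groups.lam (add_monoid X) X = brace_lambda X"
proof -
  interpret brace_groups "add_monoid X" X by (rule brace_groups)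
  show ?thesis by (intro ext) (simp add: lam_def brace_lambda_def a_inv_def)
qed

lemma lambda_action: "automorphism_action (add_monoid X) X (brace_lambda X)"
  using brace_groups.lam_action[OF brace_groups] unfolding lam_eq .

lemma left_series_eq: "left_series X n = displacement_series (add_monoid X) X (brace_lambda X) n"
  by (induction n) (simp_all add: set_star_def brace_star_def a_minus_def a_inv_def)

lemma left_series_antimono: "m \<le> n \<Longrightarrow> left_series X n \<subseteq> left_series X m"
  unfolding left_series_eq
  by (rule automorphism_action.displacement_series_antimono[OF lambda_action])

lemma left_series_subgroup: "subgroup (left_series X n) (add_monoid X)"
  unfolding left_series_eq
  using automorphism_action.displacement_series_subgroup[OF lambda_action] by blast

text \<open>
  The heart of the matter, applied below to the quotients of the given brace.
\<close>

theorem left_nilpotent_iff_nilpotent: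
  assumes "finite (carrier X)" and "nilpotent_group (add_monoid X)"
  shows "left_nilpotent X \<longleftrightarrow> nilpotent_group X"
proof -
  interpret nilpotent_type_brace_groups "add_monoid X" X
    using brace_groups assms
    by (simp add: nilpotent_type_brace_groups_def nilpotent_type_brace_groups_axioms_def)
  show ?thesis
    using left_nilpotent_if_nilpotent nilpotent_if_left_nilpotent
    unfolding lam_eq left_nilpotent_def left_series_eq by auto
qed

lemma
  assumes I: "brace_ideal X I"
  shows quotient_hom_mult: "group_hom X (X Quot I) ((+>) I)"
    and quotient_hom_add: "group_hom (add_monoid X) (add_monoid (X Quot I)) ((+>) I)"
    and quotient_surj: "(+>) I ` carrier X = carrier (X Quot I)"
proof -
  let ?Y = "X Quot I"
  interpret N: group "add_monoid X" by (rule add_group)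
  interpret A: group X by (rule mult_group)
  show surj: "(+>) I ` carrier X = carrier ?Y"
    by (auto simp: FactRing_def A_RCOSETS_def RCOSETS_def a_r_coset_def)
  have closed: "I +> a \<in> carrier ?Y" if "a \<in> carrier X" for a using surj that by blast
  have homM: "(+>) I \<in> hom X ?Y"
    using quot_mult[OF I] closed by (auto intro: homI)
  have homA: "(+>) I \<in> hom (add_monoid X) (add_monoid ?Y)"
    using quot_add[OF I] closed by (auto intro: homI)
  have zero: "I +> \<zero> = I"
    using N.coset_mult_one[of I] I subgroup.subset[of I "add_monoid X"]
    by (simp add: brace_ideal_def a_r_coset_def)
  have "?Y\<lparr>carrier := (+>) I ` carrier X, one := I +> \<one>\<rparr> = ?Y"
    unfolding surj by (simp add: FactRing_def)
  then have gM: "group ?Y" using A.hom_imp_img_group[OF homM] by simp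
  have "(add_monoid ?Y)\<lparr>carrier := (+>) I ` carrier (add_monoid X), one := I +> \<one>\<^bsub>add_monoid X\<^esub>\<rparr>
      = add_monoid ?Y"
    using surj zero by (simp add: FactRing_def)
  then have gA: "group (add_monoid ?Y)" using N.hom_imp_img_group[OF homA] by simp
  show hM: "group_hom X ?Y ((+>) I)"
    using gM A.is_group homM by (simp add: group_hom_def group_hom_axioms_def)
  show hA: "group_hom (add_monoid X) (add_monoid ?Y) ((+>) I)"
    using gA N.is_group homA by (simp add: group_hom_def group_hom_axioms_def)
qed

lemma minus_closed: "a \<in> carrier X \<Longrightarrow> \<ominus> a \<in> carrier X"
  using group.inv_closed[OF add_group, of a] by (simp add: a_inv_def)

lemma quotient_minus:
  assumes I: "brace_ideal X I" and "a \<in> carrier X"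
  shows "I +> (\<ominus> a) = \<ominus>\<^bsub>X Quot I\<^esub> (I +> a)"
  using group_hom.hom_inv[OF quotient_hom_add[OF I], of a] assms(2) by (simp add: a_inv_def)

lemma quotient_skew_brace:
  assumes I: "brace_ideal X I"
  shows "skew_brace (X Quot I)"
proof -
  let ?Y = "X Quot I"
  interpret N: group "add_monoid X" by (rule add_group)
  interpret A: group X by (rule mult_group)
  have minus: "I +> (a \<ominus> b) = (I +> a) \<ominus>\<^bsub>?Y\<^esub> (I +> b)"
    if "a \<in> carrier X" "b \<in> carrier X" for a b
    using that minus_closed by (simp add: a_minus_def quotient_minus[OF I] flip: quot_add[OF I])
  show ?thesis
  proof (rule skew_brace.intro)
    show "group (add_monoid ?Y)" using group_hom.axioms(2)[OF quotient_hom_add[OF I]] .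
    show "group ?Y" using group_hom.axioms(2)[OF quotient_hom_mult[OF I]] .
    fix a b c assume "a \<in> carrier ?Y" "b \<in> carrier ?Y" "c \<in> carrier ?Y"
    then obtain x y z where xyz: "x \<in> carrier X" "y \<in> carrier X" "z \<in> carrier X"
      and eq: "a = I +> x" "b = I +> y" "c = I +> z"
      unfolding quotient_surj[OF I, symmetric] by blast
    have c: "y \<oplus> z \<in> carrier X" "x \<otimes> y \<in> carrier X" "x \<otimes> z \<in> carrier X" "x \<otimes> y \<ominus> x \<in> carrier X"
      using xyz N.m_closed minus_closed by (auto simp: a_minus_def)
    show "a \<otimes>\<^bsub>?Y\<^esub> (b \<oplus>\<^bsub>?Y\<^esub> c) = a \<otimes>\<^bsub>?Y\<^esub> b \<ominus>\<^bsub>?Y\<^esub> a \<oplus>\<^bsub>?Y\<^esub> (a \<otimes>\<^bsub>?Y\<^esub> c)"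
      unfolding eq using xyz c brace[OF xyz]
      by (simp add: quot_add[OF I] quot_mult[OF I] flip: minus)
  qed
qed

lemma lambda_quotient:
  assumes I: "brace_ideal X I" and a: "a \<in> carrier X" and x: "x \<in> carrier X"
  shows "I +> brace_lambda X a x = brace_lambda (X Quot I) (I +> a) (I +> x)"
proof -
  interpret N: group "add_monoid X" by (rule add_group)
  interpret A: group X by (rule mult_group)
  show ?thesis
    using a x minus_closed by (simp add: brace_lambda_def quotient_minus[OF I] quot_mult[OF I]
        flip: quot_add[OF I])
qed

lemma left_nilpotent_Quot_iff:
  assumes fin: "finite (carrier X)" and I: "brace_ideal X I"
  shows "left_nilpotent (X Quot I) \<longleftrightarrow> L_infinity X \<subseteq> I"
proof -
  let ?Y = "X Quot I"
  interpret N: group "add_monoid X" by (rule add_group)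
  have sub: "subgroup I (add_monoid X)" using I by (simp add: brace_ideal_def)
  have series: "left_series ?Y n = (+>) I ` left_series X n" for n
    unfolding left_series_eq skew_brace.left_series_eq[OF quotient_skew_brace[OF I]]
    using quotient_surj[OF I] lambda_quotient[OF I]
    by (intro displacement_series_image[where k = "(+>) I"] quotient_hom_add[OF I] lambda_action) auto
  have "left_series ?Y n = {\<zero>\<^bsub>?Y\<^esub>} \<longleftrightarrow> left_series X n \<subseteq> I" for n
  proof -
    have "left_series X n \<noteq> {}" using subgroup.one_closed[OF left_series_subgroup] by blast
    then have "(\<lambda>x. I #>\<^bsub>add_monoid X\<^esub> x) ` left_series X n = {I} \<longleftrightarrow> left_series X n \<subseteq> I"
      by (rule N.image_r_coset_trivial_iff[OF sub subgroup.subset[OF left_series_subgroup]])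
    moreover have "\<zero>\<^bsub>?Y\<^esub> = I" by (simp add: FactRing_def)
    ultimately show ?thesis by (simp add: series a_r_coset_def)
  qed
  then show ?thesis
    unfolding left_nilpotent_def L_infinity_def
    using antimono_Inter_subset_iff[of "left_series X"] fin left_series_antimono by simp
qed

text \<open>
  The multiplicative group of the quotient brace consists of additive cosets and the quotient of
  the multiplicative group of multiplicative ones. Rather than identifying the two records, the
  lower central series of each is described as an image of that of \<open>X\<close>.
\<close>

lemma nilpotent_Quot_iff_Mod:
  assumes I: "brace_ideal X I"
  shows "nilpotent_group (X Quot I) \<longleftrightarrow> nilpotent_group (X Mod I)"
proof -
  interpret A: group X by (rule mult_group)
  have n: "I \<lhd> X" using I by (simp add: brace_ideal_def)
  have sub: "subgroup I X" using n by (rule normal_imp_subgroup)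
  have "lower_central (X Quot I) n = (\<lambda>x. I #> x) ` lower_central X n" for n
    unfolding lower_central_image[OF quotient_hom_mult[OF I] quotient_surj[OF I]]
    using ideal_coset_eq[OF I] subgroup.subset[OF A.lower_central_subgroup]
    by (intro image_cong) auto
  moreover have "\<one>\<^bsub>X Quot I\<^esub> = I"
    using ideal_coset_eq[OF I A.one_closed] A.coset_mult_one[OF subgroup.subset[OF sub]]
    by (simp add: FactRing_def)
  moreover have "lower_central X n \<noteq> {}" for n
    using subgroup.one_closed[OF A.lower_central_subgroup] by blast
  ultimately have "lower_central (X Quot I) n = {\<one>\<^bsub>X Quot I\<^esub>} \<longleftrightarrow> lower_central X n \<subseteq> I" for n
    using A.image_r_coset_trivial_iff[OF sub subgroup.subset[OF A.lower_central_subgroup]] by simp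
  then show ?thesis
    unfolding A.nilpotent_Mod_iff[OF n] nilpotent_group_def[of "X Quot I"]
    using skew_brace.mult_group[OF quotient_skew_brace[OF I]] by simp
qed

lemma left_nilpotent_Quot_iff_nilpotent_Mod:
  assumes fin: "finite (carrier X)" and nil: "nilpotent_group (add_monoid X)"
    and I: "brace_ideal X I"
  shows "left_nilpotent (X Quot I) \<longleftrightarrow> nilpotent_group (X Mod I)"
proof -
  have "finite (carrier (X Quot I))" using fin quotient_surj[OF I] by (metis finite_imageI)
  moreover have "nilpotent_group (add_monoid (X Quot I))"
  proof -
    obtain n where n: "lower_central (add_monoid X) n = {\<one>\<^bsub>add_monoid X\<^esub>}"
      using nil by (auto simp: nilpotent_group_def)
    interpret h: group_hom "add_monoid X" "add_monoid (X Quot I)" "(+>) I"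
      by (rule quotient_hom_add[OF I])
    have "lower_central (add_monoid (X Quot I)) n = (+>) I ` lower_central (add_monoid X) n"
      using quotient_surj[OF I] by (intro lower_central_image quotient_hom_add[OF I]) simp
    then have "lower_central (add_monoid (X Quot I)) n = {\<one>\<^bsub>add_monoid (X Quot I)\<^esub>}"
      unfolding n using h.hom_one by simp
    then show ?thesis unfolding nilpotent_group_def using h.H.is_group by blast
  qed
  ultimately show ?thesis
    using skew_brace.left_nilpotent_iff_nilpotent[OF quotient_skew_brace[OF I]]
      nilpotent_Quot_iff_Mod[OF I] by simp
qed

section \<open>The left-nilpotent residual\<close>

lemma brace_ideal_carrier: "brace_ideal X (carrier X)"
proof -
  interpret N: group "add_monoid X" by (rule add_group)
  interpret A: group X by (rule mult_group)
  interpret lam: automorphism_action "add_monoid X" X "brace_lambda X" by (rule lambda_action)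
  show ?thesis
    using N.subgroup_self A.subgroup_self lam.closed N.m_closed[simplified] N.inv_closed[simplified]
    by (auto simp: brace_ideal_def N.normal_inv_iff A.normal_inv_iff)
qed

lemma brace_ideal_Inter:
  assumes F: "\<And>I. I \<in> F \<Longrightarrow> brace_ideal X I" and "F \<noteq> {}"
  shows "brace_ideal X (\<Inter>F)"
proof -
  interpret N: group "add_monoid X" by (rule add_group)
  interpret A: group X by (rule mult_group)
  have sub: "subgroup I (add_monoid X)" "subgroup I X" if "I \<in> F" for I
    using F[OF that] normal_imp_subgroup by (auto simp: brace_ideal_def)
  have "\<Inter>F \<lhd> add_monoid X"
  proof (rule N.normal_invI)
    show "subgroup (\<Inter>F) (add_monoid X)" by (rule N.subgroups_Inter[OF sub(1) assms(2)])
    fix x h assume "x \<in> carrier (add_monoid X)" "h \<in> \<Inter>F"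
    then show "x \<otimes>\<^bsub>add_monoid X\<^esub> h \<otimes>\<^bsub>add_monoid X\<^esub> inv\<^bsub>add_monoid X\<^esub> x \<in> \<Inter>F"
      using F N.normal_invE(2) unfolding brace_ideal_def by blast
  qed
  moreover have "\<Inter>F \<lhd> X"
  proof (rule A.normal_invI)
    show "subgroup (\<Inter>F) X" by (rule A.subgroups_Inter[OF sub(2) assms(2)])
    fix x h assume "x \<in> carrier X" "h \<in> \<Inter>F"
    then show "x \<otimes> h \<otimes> inv x \<in> \<Inter>F"
      using F A.normal_invE(2) unfolding brace_ideal_def by blast
  qed
  ultimately show ?thesis
    using F normal_imp_subgroup unfolding brace_ideal_def by blast
qed

lemma ideal_generated_eq_Inter:
  assumes "S \<subseteq> carrier X"
  shows "ideal_generated X S = \<Inter>{I. brace_ideal X I \<and> S \<subseteq> I}"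
  unfolding ideal_generated_def
proof (rule Least_equality)
  show "brace_ideal X (\<Inter>{I. brace_ideal X I \<and> S \<subseteq> I}) \<and> S \<subseteq> \<Inter>{I. brace_ideal X I \<and> S \<subseteq> I}"
  proof (intro conjI brace_ideal_Inter)
    show "{I. brace_ideal X I \<and> S \<subseteq> I} \<noteq> {}" using brace_ideal_carrier assms by blast
  qed blast+
next
  fix I assume "brace_ideal X I \<and> S \<subseteq> I"
  then show "\<Inter>{I. brace_ideal X I \<and> S \<subseteq> I} \<subseteq> I" by (intro Inter_lower) simp
qed

end

theorem theorem6p2:
  fixes X :: "('a, 'b) ring_scheme"
  assumes "skew_brace X"
    and "finite (carrier X)"
    and "nilpotent_group (add_monoid X)"
  shows "left_nilpotent_residual X = ideal_generated X (L_infinity X) \<and>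
         ideal_generated X (L_infinity X) = ideal_generated X (gamma_infinity X) \<and>
         brace_ideal X (left_nilpotent_residual X) \<and>
         nilpotent_group (X Mod left_nilpotent_residual X) \<and>
         (\<forall>I. brace_ideal X I \<and> nilpotent_group (X Mod I) \<longrightarrow> left_nilpotent_residual X \<subseteq> I)"
proof -
  interpret skew_brace X by (rule assms(1))
  interpret A: group X by (rule mult_group)
  have left: "left_nilpotent (X Quot I) \<longleftrightarrow> L_infinity X \<subseteq> I" if "brace_ideal X I" for I
    by (rule left_nilpotent_Quot_iff[OF assms(2) that])
  have gamma: "nilpotent_group (X Mod I) \<longleftrightarrow> gamma_infinity X \<subseteq> I" if "brace_ideal X I" for I
    using that by (intro A.nilpotent_Mod_iff_gamma_infinity[OF assms(2)]) (simp add: brace_ideal_def)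
  have same: "left_nilpotent (X Quot I) \<longleftrightarrow> nilpotent_group (X Mod I)" if "brace_ideal X I" for I
    by (rule left_nilpotent_Quot_iff_nilpotent_Mod[OF assms(2,3) that])
  let ?R = "left_nilpotent_residual X"
  have R_L: "?R = \<Inter>{I. brace_ideal X I \<and> L_infinity X \<subseteq> I}"
    unfolding left_nilpotent_residual_def
    by (intro arg_cong[where f = Inter] Collect_cong conj_cong refl left)
  have R_gamma: "?R = \<Inter>{I. brace_ideal X I \<and> gamma_infinity X \<subseteq> I}"
    unfolding left_nilpotent_residual_def
    by (intro arg_cong[where f = Inter] Collect_cong conj_cong refl) (simp add: same gamma)
  have L: "L_infinity X \<subseteq> carrier X"
    unfolding L_infinity_def by (rule INF_lower2[of 0]) simp_all
  then have gamma_sub: "gamma_infinity X \<subseteq> carrier X"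
    using left same gamma brace_ideal_carrier by simp
  have gen_L: "ideal_generated X (L_infinity X) = ?R"
    unfolding R_L by (rule ideal_generated_eq_Inter[OF L])
  have gen_gamma: "ideal_generated X (gamma_infinity X) = ?R"
    unfolding R_gamma by (rule ideal_generated_eq_Inter[OF gamma_sub])
  have R: "brace_ideal X ?R"
    unfolding R_gamma
  proof (rule brace_ideal_Inter)
    show "{I. brace_ideal X I \<and> gamma_infinity X \<subseteq> I} \<noteq> {}"
      using brace_ideal_carrier gamma_sub by blast
  qed simp
  have "gamma_infinity X \<subseteq> ?R" unfolding R_gamma by (rule Inter_greatest) simp
  then have "nilpotent_group (X Mod ?R)" by (simp add: gamma[OF R])
  moreover have "?R \<subseteq> I" if "brace_ideal X I \<and> nilpotent_group (X Mod I)" for I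
    unfolding R_gamma by (intro Inter_lower) (use that gamma in auto)
  ultimately show ?thesis using gen_L gen_gamma R by simp
qed

end
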